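(* The following decision problem is solvable in polynomial time. Input: a finite set of $m$ candidates, a distinguished candidate $p$, a finite list of (complete or partial) unweighted votes of the non-manipulators, and a number of manipulators. Question: can each manipulator cast a (complete or partial) unweighted vote such that $p$ wins the election under the rule Borda$_{\uparrow}$ applied to all the votes (non-manipulators and manipulators together)?
   Context: A complete vote is a linear order over all $m$ candidates; a partial vote is a linear order over a strict subset of the candidates (the candidates in the subset are the ranked ones, in order of preference from 1st to $k$th; the others are unranked). The Borda scores are $s_i = m-i$ for $i=1,\dots,m$; a complete vote gives its $i$th ranked candidate $s_i$ points. Under Borda$_{\uparrow}$ ("round up"), a partial vote ranking $k<m$ candidates gives $s_i$ points to its $i$th ranked candidate ($i\le k$) and $0$ points to every unranked candidate. The candidate with highest total score wins; ties are broken in favour of the manipulators, so $p$ wins iff its total score is at least that of every other candidate. The manipulators have complete knowledge of the other votes. The number of candidates is not bounded. *)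

theory Defs
  imports "HOL-Computational_Algebra.Polynomial"
begin

section \<open>Voting with complete and partial votes under Borda, rounding up\<close>

text \<open>A vote is the list of its ranked candidates, most preferred first.\<close>

definition complete_vote :: "'c set \<Rightarrow> 'c list \<Rightarrow> bool" where
  "complete_vote C v \<longleftrightarrow> distinct v \<and> set v = C"

definition partial_vote :: "'c set \<Rightarrow> 'c list \<Rightarrow> bool" where
  "partial_vote C v \<longleftrightarrow> distinct v \<and> set v \<subset> C"

definition is_vote :: "'c set \<Rightarrow> 'c list \<Rightarrow> bool" where
  "is_vote C v \<longleftrightarrow> complete_vote C v \<or> partial_vote C v"

text \<open>Positions are counted from 1.\<close>

definition position :: "'c list \<Rightarrow> 'c \<Rightarrow> nat" where
  "position v c = Suc (length (takeWhile (\<lambda>d. d \<noteq> c) v))"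

definition borda :: "nat \<Rightarrow> nat \<Rightarrow> nat" where
  "borda m i = m - i"

text \<open>A complete vote leaves nobody unranked, so one clause serves both kinds of vote.\<close>

definition points_up :: "'c set \<Rightarrow> 'c list \<Rightarrow> 'c \<Rightarrow> nat" where
  "points_up C v c = (if c \<in> set v then borda (card C) (position v c) else 0)"

definition score_up :: "'c set \<Rightarrow> 'c list list \<Rightarrow> 'c \<Rightarrow> nat" where
  "score_up C vs c = (\<Sum>v\<leftarrow>vs. points_up C v c)"

definition wins_up :: "'c set \<Rightarrow> 'c list list \<Rightarrow> 'c \<Rightarrow> bool" where
  "wins_up C vs p \<longleftrightarrow> (\<forall>c\<in>C. score_up C vs c \<le> score_up C vs p)"

definition manipulable_up :: "'c set \<Rightarrow> 'c \<Rightarrow> 'c list list \<Rightarrow> nat \<Rightarrow> bool" where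
  "manipulable_up C p vs n \<longleftrightarrow>
     (\<exists>ms. length ms = n \<and> (\<forall>v\<in>set ms. is_vote C v) \<and> wins_up C (vs @ ms) p)"

section \<open>Instances and their encoding as words\<close>

text \<open>
  The candidate set is given by an enumeration \<open>cs\<close> without repetitions, \<open>vs\<close> are the votes of
  the non-manipulators and \<open>n\<close> is the number of manipulators.
\<close>

definition is_manip_input :: "'c list \<Rightarrow> 'c \<Rightarrow> 'c list list \<Rightarrow> nat \<Rightarrow> bool" where
  "is_manip_input cs p vs n \<longleftrightarrow> distinct cs \<and> p \<in> set cs \<and> (\<forall>v\<in>set vs. is_vote (set cs) v)"

text \<open>Binary notation, least significant bit first; zero is the empty word.\<close>

fun binary :: "nat \<Rightarrow> bool list" where
  "binary n = (if n = 0 then [] else odd n # binary (n div 2))"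

declare binary.simps [simp del]

datatype letter = Bit bool | Comma | Semicolon

definition enc_string :: "bool list \<Rightarrow> letter list" where
  "enc_string bs = map Bit bs @ [Comma]"

definition enc_strings :: "bool list list \<Rightarrow> letter list" where
  "enc_strings xs = concat (map enc_string xs) @ [Semicolon]"

text \<open>
  Candidates are named by arbitrary bit strings.  Every candidate is listed explicitly, whereas
  the number of manipulators is written in binary.
\<close>

definition enc_input ::
    "bool list list \<Rightarrow> bool list \<Rightarrow> bool list list list \<Rightarrow> nat \<Rightarrow> letter list" where
  "enc_input cs p vs n =
     enc_string (binary n) @ enc_string p @ enc_strings cs @ concat (map enc_strings vs)"

lemma horner_sum_binary: "horner_sum of_bool 2 (binary n) = n"
proof (induction n rule: binary.induct)
  case (1 n)
  show ?case
  proof (cases "n = 0")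
    case True
    then show ?thesis by (simp add: binary.simps)
  next
    case False
    then have "horner_sum of_bool 2 (binary n) = of_bool (odd n) + 2 * (n div 2)"
      using 1 by (subst binary.simps) simp
    also have "\<dots> = n" by (cases "even n") (simp_all add: odd_two_times_div_two_succ)
    finally show ?thesis .
  qed
qed

lemma binary_inject: "binary m = binary n \<longleftrightarrow> m = n"
  by (metis horner_sum_binary)

lemma enc_string_append_inject: "enc_string a @ x = enc_string b @ y \<longleftrightarrow> a = b \<and> x = y"
proof (induction a arbitrary: b)
  case Nil
  show ?case by (cases b) (auto simp: enc_string_def)
next
  case (Cons h a)
  then show ?case by (cases b) (auto simp: enc_string_def)
qed

lemma enc_string_neq_Semicolon: "enc_string a @ x \<noteq> Semicolon # y"
  by (cases a) (auto simp: enc_string_def)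

lemma enc_strings_append_inject: "enc_strings a @ x = enc_strings b @ y \<longleftrightarrow> a = b \<and> x = y"
proof (induction a arbitrary: b)
  case Nil
  show ?case
    by (cases b) (auto simp: enc_strings_def enc_string_neq_Semicolon[symmetric])
next
  case (Cons h a)
  show ?case
  proof (cases b)
    case Nil
    then show ?thesis by (auto simp: enc_strings_def enc_string_neq_Semicolon)
  next
    case (Cons h' b')
    then show ?thesis using Cons.IH[of b']
      by (auto simp: enc_strings_def enc_string_append_inject)
  qed
qed

lemma concat_enc_strings_inject:
  "concat (map enc_strings vs) = concat (map enc_strings ws) \<longleftrightarrow> vs = ws"
proof (induction vs arbitrary: ws)
  case Nil
  show ?case by (cases ws) (auto simp: enc_strings_def)
next
  case (Cons v vs)
  then show ?case
    by (cases ws) (auto simp: enc_strings_append_inject, auto simp: enc_strings_def)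
qed

lemma enc_input_inject:
  "enc_input cs p vs n = enc_input cs' p' vs' n' \<longleftrightarrow> cs = cs' \<and> p = p' \<and> vs = vs' \<and> n = n'"
  by (auto simp: enc_input_def enc_string_append_inject enc_strings_append_inject
      concat_enc_strings_inject binary_inject)

section \<open>Deterministic multi-tape Turing machines and polynomial time\<close>

datatype move = Go_Left | Stay | Go_Right

text \<open>
  States and tape symbols are initial segments of the natural numbers.  Symbol 0 is the blank;
  state 0 is the start state, state 1 accepts and state 2 rejects.  The map \<open>tm_letter\<close> embeds
  the input alphabet into the non-blank tape symbols.
\<close>

record 'a tm =
  tm_tapes :: nat
  tm_states :: nat
  tm_symbols :: nat
  tm_letter :: "'a \<Rightarrow> nat"
  tm_delta :: "nat \<Rightarrow> nat list \<Rightarrow> nat \<times> (nat \<times> move) list"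

text \<open>
  Well-formedness confines the machine to its finitely many states and symbols, so that only a
  finite part of the transition function is ever consulted.  As \<open>tm_letter\<close> is injective, it
  also makes the input alphabet finite.
\<close>

definition is_tm :: "'a tm \<Rightarrow> bool" where
  "is_tm M \<longleftrightarrow>
     1 \<le> tm_tapes M \<and> 3 \<le> tm_states M \<and>
     inj (tm_letter M) \<and> range (tm_letter M) \<subseteq> {1..<tm_symbols M} \<and>
     (\<forall>q xs. q < tm_states M \<and> length xs = tm_tapes M \<and> set xs \<subseteq> {..<tm_symbols M} \<longrightarrow>
        (case tm_delta M q xs of (q', as) \<Rightarrow>
           q' < tm_states M \<and> length as = tm_tapes M \<and> fst ` set as \<subseteq> {..<tm_symbols M}))"

text \<open>A tape consists of the contents of its cells, infinite in both directions, and the head position.\<close>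

type_synonym tape = "(int \<Rightarrow> nat) \<times> int"

type_synonym config = "nat \<times> tape list"

fun tape_read :: "tape \<Rightarrow> nat" where
  "tape_read (f, h) = f h"

fun head_move :: "move \<Rightarrow> int \<Rightarrow> int" where
  "head_move Go_Left h = h - 1"
| "head_move Stay h = h"
| "head_move Go_Right h = h + 1"

fun tape_act :: "nat \<times> move \<Rightarrow> tape \<Rightarrow> tape" where
  "tape_act (a, d) (f, h) = (f(h := a), head_move d h)"

definition tm_step :: "'a tm \<Rightarrow> config \<Rightarrow> config" where
  "tm_step M = (\<lambda>(q, ts).
     if q = 1 \<or> q = 2 then (q, ts)
     else case tm_delta M q (map tape_read ts) of (q', as) \<Rightarrow> (q', map2 tape_act as ts))"

definition blank_tape :: tape where
  "blank_tape = (\<lambda>_. 0, 0)"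

definition input_tape :: "'a tm \<Rightarrow> 'a list \<Rightarrow> tape" where
  "input_tape M w =
     (\<lambda>i. if 0 \<le> i \<and> i < int (length w) then tm_letter M (w ! nat i) else 0, 0)"

definition tm_start :: "'a tm \<Rightarrow> 'a list \<Rightarrow> config" where
  "tm_start M w = (0, input_tape M w # replicate (tm_tapes M - 1) blank_tape)"

definition decides_in_time :: "'a tm \<Rightarrow> (nat \<Rightarrow> nat) \<Rightarrow> 'a list set \<Rightarrow> bool" where
  "decides_in_time M T L \<longleftrightarrow>
     (\<forall>w. \<exists>t \<le> T (length w).
        fst ((tm_step M ^^ t) (tm_start M w)) = (if w \<in> L then 1 else 2))"

definition poly_time_decidable :: "'a list set \<Rightarrow> bool" where
  "poly_time_decidable L \<longleftrightarrow>
     (\<exists>(M :: 'a tm) (P :: nat poly). is_tm M \<and> decides_in_time M (poly P) L)"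

end

theory Submission
  imports Defs
begin

text \<open>
  Ranking \<open>p\<close> alone gives \<open>p\<close> the maximal number of points and the other candidates none, so it is
  an optimal vote for every manipulator.  Hence the manipulators succeed iff the score of every
  candidate \<open>c\<close> is at most \<open>score p + n * (m - 1)\<close>, where the scores are those of the given votes.

  A Turing machine can check this because polynomial-time functions on words, computed by structured
  programs whose tapes are used as stacks, are closed under composition, case distinction and
  recursion over the tails of a word, provided that the recursion lets the accumulator grow by at
  most a polynomial amount in each step.  A program becomes a machine by taking the residual programs
  of its small-step semantics, of which there are only finitely many, as states.  With bounded
  quantifiers and sums over the tails of a word, the validity of the input and the inequalities
  between the scores can then be written down directly.
\<close>

section \<open>Structured programs on tapes\<close>

text \<open>The number \<open>n\<close> is written in binary, so \<open>n * (m - 1)\<close> can be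
  exponentially long in unary, the notation of all other numbers. It is only compared with the score
  of \<open>c\<close>, which is polynomial in the input length because all candidates and votes are
  listed explicitly; hence the product may be cut off at that score. The cutoff also fits the
  conversion from binary to unary, whose steps double the accumulator, into the recursion scheme.
  There the permitted growth depends on the remaining word and the parameters but not on the
  accumulator, so that increments add up; unrestricted doubling along a word of length
  \<open>l\<close> could reach length \<open>2 ^ l\<close>.

  The machine must answer on every word, so encodings have to be recognised too. Two local tests
  suffice to see that a word is a list of blocks of strings: it ends with a semicolon, and no bit
  stands directly before a semicolon. All remaining conditions speak about positions of strings in
  their blocks.\<close>

fun symbol :: "letter option \<Rightarrow> nat" where
  "symbol None = 0"
| "symbol (Some (Bit b)) = (if b then 2 else 1)"
| "symbol (Some Comma) = 3"
| "symbol (Some Semicolon) = 4"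

lemma inj_symbol: "inj symbol"
proof (rule injI)
  fix x y assume "symbol x = symbol y"
  then show "x = y"
    by (cases x rule: symbol.cases; cases y rule: symbol.cases) (auto split: if_splits)
qed

lemma symbol_less: "symbol x < 5"
  by (cases x rule: symbol.cases) auto

lemma symbol_eq_0 [simp]: "symbol x = 0 \<longleftrightarrow> x = None"
  by (cases x rule: symbol.cases) auto

definition unsymbol :: "nat \<Rightarrow> letter option" where
  "unsymbol = inv symbol"

lemma unsymbol_symbol [simp]: "unsymbol (symbol x) = x"
  by (simp add: unsymbol_def inj_symbol)

text \<open>\<open>Write\<close> and \<open>Branch\<close> look at two heads at once, so that
  letters are copied and compared between tapes without being remembered in the control. The control
  state is thus just the program that remains to be run; \<open>None\<close> stands for a
  blank.\<close>

datatype prog =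
  Skip
| Write nat nat "letter option \<Rightarrow> letter option"
| Move nat move
| Seq prog prog
| Branch nat nat "letter option \<Rightarrow> letter option \<Rightarrow> bool" prog prog
| Loop nat "letter option \<Rightarrow> bool" prog

fun tape_bound :: "prog \<Rightarrow> nat" where
  "tape_bound Skip = 0"
| "tape_bound (Write i j g) = Suc (max i j)"
| "tape_bound (Move i d) = Suc i"
| "tape_bound (Seq P Q) = max (tape_bound P) (tape_bound Q)"
| "tape_bound (Branch i j b P Q) = max (Suc (max i j)) (max (tape_bound P) (tape_bound Q))"
| "tape_bound (Loop i b P) = max (Suc i) (tape_bound P)"

text \<open>One machine step, given the symbols \<open>\<rho>\<close> under the heads of infinitely
  many tapes. Purely administrative steps, such as discarding a finished first component of
  \<open>Seq\<close>, also take one time unit and rewrite each scanned symbol by itself.\<close>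

fun pnext :: "prog \<Rightarrow> (nat \<Rightarrow> nat) \<Rightarrow> prog \<times> (nat \<Rightarrow> nat \<times> move)" where
  "pnext Skip \<rho> = (Skip, \<lambda>k. (\<rho> k, Stay))"
| "pnext (Write i j g) \<rho> = (Skip, \<lambda>k. (if k = i then symbol (g (unsymbol (\<rho> j))) else \<rho> k, Stay))"
| "pnext (Move i d) \<rho> = (Skip, \<lambda>k. (\<rho> k, if k = i then d else Stay))"
| "pnext (Seq P Q) \<rho> =
     (if P = Skip then (Q, \<lambda>k. (\<rho> k, Stay)) else (Seq (fst (pnext P \<rho>)) Q, snd (pnext P \<rho>)))"
| "pnext (Branch i j b P Q) \<rho> =
     (if b (unsymbol (\<rho> i)) (unsymbol (\<rho> j)) then P else Q, \<lambda>k. (\<rho> k, Stay))"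
| "pnext (Loop i b P) \<rho> =
     (if b (unsymbol (\<rho> i)) then Seq P (Loop i b P) else Skip, \<lambda>k. (\<rho> k, Stay))"

text \<open>Unrolling a loop does not let programs grow: once the body is finished,
  \<open>Seq Skip (Loop i b P)\<close> steps back to the loop itself. This is why finitely many
  residuals are closed under \<open>pnext\<close>.\<close>

fun residuals :: "prog \<Rightarrow> prog set" where
  "residuals Skip = {Skip}"
| "residuals (Write i j g) = {Write i j g, Skip}"
| "residuals (Move i d) = {Move i d, Skip}"
| "residuals (Seq P Q) = (\<lambda>P'. Seq P' Q) ` residuals P \<union> residuals Q"
| "residuals (Branch i j b P Q) = {Branch i j b P Q} \<union> residuals P \<union> residuals Q"
| "residuals (Loop i b P) = {Loop i b P, Skip} \<union> (\<lambda>P'. Seq P' (Loop i b P)) ` residuals P"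

lemma finite_residuals: "finite (residuals P)"
  by (induction P) auto

lemma self_in_residuals: "P \<in> residuals P"
  by (induction P) auto

lemma pnext_in_residuals: "P' \<in> residuals P \<Longrightarrow> fst (pnext P' \<rho>) \<in> residuals P"
proof (induction P arbitrary: P')
  case (Loop i b P)
  then show ?case by (cases "P' = Loop i b P") (auto simp: self_in_residuals split: if_splits)
qed (auto simp: self_in_residuals)

lemma tape_bound_residuals: "P' \<in> residuals P \<Longrightarrow> tape_bound P' \<le> tape_bound P"
  by (induction P arbitrary: P'; auto; meson max.coboundedI1 max.coboundedI2)

text \<open>This justifies replacing the infinite family of tapes by the first \<open>K\<close>
  ones: symbols beyond them influence neither the residual program nor the actions on these
  tapes.\<close>

lemma pnext_cong:
  assumes "tape_bound P \<le> K" and "\<And>i. i < K \<Longrightarrow> \<rho> i = \<rho>' i"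
  shows "fst (pnext P \<rho>) = fst (pnext P \<rho>')"
    and "i < K \<Longrightarrow> snd (pnext P \<rho>) i = snd (pnext P \<rho>') i"
  using assms by (induction P) auto

lemma pnext_symbol_less: "(\<And>i. \<rho> i < 5) \<Longrightarrow> fst (snd (pnext P \<rho>) i) < 5"
  by (induction P) (auto simp: symbol_less)

definition pstep :: "prog \<times> (nat \<Rightarrow> tape) \<Rightarrow> prog \<times> (nat \<Rightarrow> tape)" where
  "pstep = (\<lambda>(P, \<tau>). let (P', a) = pnext P (\<lambda>i. tape_read (\<tau> i))
     in (P', \<lambda>i. tape_act (a i) (\<tau> i)))"

inductive halts :: "prog \<Rightarrow> (nat \<Rightarrow> tape) \<Rightarrow> nat \<Rightarrow> (nat \<Rightarrow> tape) \<Rightarrow> bool" where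
  halts_Skip: "halts Skip \<tau> 0 \<tau>"
| halts_step: "P \<noteq> Skip \<Longrightarrow> pstep (P, \<tau>) = (P', \<tau>') \<Longrightarrow> halts P' \<tau>' t \<tau>'' \<Longrightarrow> halts P \<tau> (Suc t) \<tau>''"

lemma tape_act_read [simp]: "tape_act (tape_read t, Stay) t = t"
  by (cases t) auto

lemma halts_Seq:
  assumes "halts P \<tau> t \<tau>'" and "halts Q \<tau>' t' \<tau>''"
  shows "halts (Seq P Q) \<tau> (t + t' + 1) \<tau>''"
  using assms
proof induction
  case (halts_Skip \<tau>)
  then show ?case using halts.halts_step[of "Seq Skip Q" \<tau> Q \<tau>]
    by (simp add: pstep_def)
next
  case (halts_step P \<tau> P' \<tau>' t \<tau>\<^sub>1)
  then have "pstep (Seq P Q, \<tau>) = (Seq P' Q, \<tau>')"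
    by (auto simp: pstep_def split_beta)
  with halts_step show ?case
    using halts.halts_step[of "Seq P Q" \<tau> "Seq P' Q" \<tau>'] by simp
qed

lemma halts_Branch:
  assumes "halts (if b (unsymbol (tape_read (\<tau> i))) (unsymbol (tape_read (\<tau> j))) then P else Q) \<tau> t \<tau>'"
  shows "halts (Branch i j b P Q) \<tau> (Suc t) \<tau>'"
  by (rule halts_step[OF _ _ assms]) (auto simp: pstep_def)

lemma halts_Loop_False:
  assumes "\<not> b (unsymbol (tape_read (\<tau> i)))"
  shows "halts (Loop i b P) \<tau> 1 \<tau>"
  using halts_step[of "Loop i b P" \<tau> Skip \<tau> 0 \<tau>] assms by (simp add: pstep_def halts_Skip)

lemma halts_Loop_True:
  assumes "b (unsymbol (tape_read (\<tau> i)))" and "halts P \<tau> t \<tau>'" and "halts (Loop i b P) \<tau>' t' \<tau>''"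
  shows "halts (Loop i b P) \<tau> (t + t' + 2) \<tau>''"
  using halts_step[of "Loop i b P" \<tau> "Seq P (Loop i b P)" \<tau>] halts_Seq[OF assms(2,3)] assms(1)
  by (simp add: pstep_def)

lemma halts_Write:
  "halts (Write i j g) \<tau> 1
     (\<tau>(i := tape_act (symbol (g (unsymbol (tape_read (\<tau> j)))), Stay) (\<tau> i)))"
  using halts_step[OF _ _ halts_Skip, of "Write i j g" \<tau>] by (auto simp: pstep_def fun_eq_iff)

lemma halts_Move:
  "halts (Move i d) \<tau> 1 (\<tau>(i := tape_act (tape_read (\<tau> i), d) (\<tau> i)))"
  using halts_step[OF _ _ halts_Skip, of "Move i d" \<tau>] by (auto simp: pstep_def fun_eq_iff)

section \<open>Compilation to Turing machines\<close>

text \<open>Convention for the answer: when the program has ended, one more step accepts iff tape 1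
  shows a non-blank symbol. Numbers that encode no residual get a harmless transition, because
  well-formedness constrains \<open>tm_delta\<close> on all states, even on the halting
  ones.\<close>

definition prog_tm :: "nat \<Rightarrow> prog set \<Rightarrow> (prog \<Rightarrow> nat) \<Rightarrow> nat \<Rightarrow> letter tm" where
  "prog_tm K R e N = \<lparr>tm_tapes = K, tm_states = N, tm_symbols = 5,
     tm_letter = (\<lambda>a. symbol (Some a)),
     tm_delta = (\<lambda>q xs.
       let P = inv_into R e q; n = pnext P (\<lambda>i. if i < K then xs ! i else 0)
       in if q \<notin> e ` R then (0, map (\<lambda>x. (x, Stay)) xs)
          else if P = Skip then (if xs ! 1 \<noteq> 0 then 1 else 2, map (\<lambda>x. (x, Stay)) xs)
          else (e (fst n), map (snd n) [0..<K]))\<rparr>"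

locale compiled =
  fixes P\<^sub>0 :: prog and K :: nat and e :: "prog \<Rightarrow> nat" and N :: nat
  assumes tapes: "2 \<le> K" "tape_bound P\<^sub>0 \<le> K"
    and inj: "inj_on e (residuals P\<^sub>0)"
    and start: "e P\<^sub>0 = 0"
    and states: "3 \<le> N" "\<And>P. P \<in> residuals P\<^sub>0 \<Longrightarrow> e P < N \<and> e P \<noteq> 1 \<and> e P \<noteq> 2"
begin

abbreviation M :: "letter tm" where
  "M \<equiv> prog_tm K (residuals P\<^sub>0) e N"

lemma is_tm: "is_tm M"
proof -
  have "case tm_delta M q xs of (q', as) \<Rightarrow>
      q' < N \<and> length as = K \<and> fst ` set as \<subseteq> {..<5}"
    if q: "q < N" and xs: "length xs = K" "set xs \<subseteq> {..<5}" for q xs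
  proof (cases "q \<in> e ` residuals P\<^sub>0 \<and> inv_into (residuals P\<^sub>0) e q \<noteq> Skip")
    case True
    let ?P = "inv_into (residuals P\<^sub>0) e q"
    have "?P \<in> residuals P\<^sub>0" using True by (simp add: inv_into_into)
    then have "e (fst (pnext ?P \<rho>)) < N" for \<rho>
      using states(2) pnext_in_residuals by blast
    moreover have "fst (snd (pnext ?P (\<lambda>i. if i < K then xs ! i else 0)) i) < 5" for i
      using xs by (intro pnext_symbol_less) (auto simp: subset_iff)
    ultimately show ?thesis using True by (auto simp: prog_tm_def Let_def)
  next
    case False
    then show ?thesis using xs states(1) by (auto simp: prog_tm_def Let_def)
  qed
  moreover have "inj (\<lambda>a. symbol (Some a))"
    by (metis (mono_tags) injI inj_symbol injD option.inject)
  moreover have "range (\<lambda>a. symbol (Some a)) \<subseteq> {1..<5}"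
    using symbol_less by (auto simp: Suc_le_eq neq0_conv[symmetric] simp del: neq0_conv)
  ultimately show ?thesis using tapes states(1) by (auto simp: is_tm_def prog_tm_def)
qed

lemma tm_step_pstep:
  assumes P: "P \<in> residuals P\<^sub>0" "P \<noteq> Skip" and "pstep (P, \<tau>) = (P', \<tau>')"
  shows "tm_step M (e P, map \<tau> [0..<K]) = (e P', map \<tau>' [0..<K])"
proof -
  let ?\<rho> = "\<lambda>i. tape_read (\<tau> i)"
  let ?\<rho>' = "\<lambda>i. if i < K then map tape_read (map \<tau> [0..<K]) ! i else 0"
  have K: "tape_bound P \<le> K" using tape_bound_residuals P(1) tapes(2) by fastforce
  have inv: "inv_into (residuals P\<^sub>0) e (e P) = P" using P(1) inj by simp
  have "P' = fst (pnext P ?\<rho>')" "\<And>i. i < K \<Longrightarrow> \<tau>' i = tape_act (snd (pnext P ?\<rho>') i) (\<tau> i)"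
    using pnext_cong[OF K, of ?\<rho> ?\<rho>'] assms(3) by (auto simp: pstep_def split_beta)
  moreover have "map2 tape_act (map a [0..<K]) (map \<tau> [0..<K])
      = map (\<lambda>i. tape_act (a i) (\<tau> i)) [0..<K]" for a
    by (simp add: map2_map_map)
  ultimately show ?thesis
    using P inv states(2)[OF P(1)] by (auto simp: tm_step_def prog_tm_def Let_def comp_def)
qed

text \<open>That \<open>Skip\<close> is a residual is carried through the induction because the
  state \<open>e Skip\<close> can only be decoded in that case.\<close>

lemma tm_steps_halts:
  assumes "halts P \<tau> t \<tau>'" and "P \<in> residuals P\<^sub>0"
  shows "(tm_step M ^^ t) (e P, map \<tau> [0..<K]) = (e Skip, map \<tau>' [0..<K]) \<and> Skip \<in> residuals P\<^sub>0"
  using assms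
proof induction
  case (halts_step P \<tau> P' \<tau>' t \<tau>'')
  have "P' \<in> residuals P\<^sub>0"
    using pnext_in_residuals[OF halts_step.prems] halts_step.hyps(2)
    by (auto simp: pstep_def split_beta)
  then show ?case
    using tm_step_pstep[OF halts_step.prems halts_step.hyps(1,2)] halts_step.IH
    by (simp add: funpow_Suc_right del: funpow.simps)
qed simp

lemma tm_accepts:
  assumes "halts P\<^sub>0 \<tau> t \<tau>'"
  shows "fst ((tm_step M ^^ Suc t) (0, map \<tau> [0..<K])) = (if tape_read (\<tau>' 1) \<noteq> 0 then 1 else 2)"
proof -
  have *: "(tm_step M ^^ t) (0, map \<tau> [0..<K]) = (e Skip, map \<tau>' [0..<K])" "Skip \<in> residuals P\<^sub>0"
    using tm_steps_halts[OF assms self_in_residuals] start by auto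
  have "inv_into (residuals P\<^sub>0) e (e Skip) = Skip" using *(2) inj by simp
  then have "fst (tm_step M (e Skip, map \<tau>' [0..<K])) = (if tape_read (\<tau>' 1) \<noteq> 0 then 1 else 2)"
    using *(2) states(2)[OF *(2)] tapes(1) by (simp add: tm_step_def prog_tm_def Let_def)
  then show ?thesis by (simp add: *(1))
qed

end

lemma ex_compiled: "\<exists>K e N. compiled P K e N"
proof -
  obtain h :: "prog \<Rightarrow> nat" where h: "bij_betw h (residuals P) {0..<card (residuals P)}"
    using ex_bij_betw_finite_nat[OF finite_residuals] by blast
  \<comment> \<open>The start state must be 0, and the shift by 3 keeps the other residuals away
    from 0 and from the halting states 1 and 2.\<close>
  define e where "e = (\<lambda>Q. if Q = P then 0 else h Q + 3)"
  have "compiled P (max 2 (tape_bound P)) e (card (residuals P) + 3)"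
  proof
    show "inj_on e (residuals P)"
      using bij_betw_imp_inj_on[OF h] by (auto simp: inj_on_def e_def)
    show "e Q < card (residuals P) + 3 \<and> e Q \<noteq> 1 \<and> e Q \<noteq> 2" if "Q \<in> residuals P" for Q
      using bij_betwE[OF h] that by (auto simp: e_def)
  qed (auto simp: e_def)
  then show ?thesis by blast
qed

section \<open>Tapes as stacks\<close>

fun head :: "letter list \<Rightarrow> letter option" where
  "head [] = None"
| "head (x # xs) = Some x"

lemma head_eq_None [simp]: "head xs = None \<longleftrightarrow> xs = []"
  by (cases xs) auto

definition cell :: "letter list \<Rightarrow> int \<Rightarrow> nat" where
  "cell xs j = (if 0 \<le> j \<and> j < int (length xs) then symbol (Some (xs ! nat j)) else 0)"

text \<open>The top of the stack is under the head, so that the input tape holds the input word.\<close>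

definition stack_tape :: "letter list \<Rightarrow> tape \<Rightarrow> bool" where
  "stack_tape xs t \<longleftrightarrow> (\<forall>j. fst t (snd t + j) = cell xs j)"

lemma tape_read_stack: "stack_tape xs t \<Longrightarrow> tape_read t = symbol (head xs)"
  by (cases t; cases xs) (auto simp: stack_tape_def cell_def dest: spec[of _ 0])

lemma unsymbol_tape_read: "\<forall>i. stack_tape (\<sigma> i) (\<tau> i) \<Longrightarrow> unsymbol (tape_read (\<tau> i)) = head (\<sigma> i)"
  by (metis tape_read_stack unsymbol_symbol)

lemma cell_Cons: "cell (x # xs) j = (if j = 0 then symbol (Some x) else cell xs (j - 1))"
  by (auto simp: cell_def nth_Cons' nat_diff_distrib' intro!: arg_cong[where f = symbol])

text \<open>Stacks grow to the left: the head first steps onto the blank cell beside the top and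
  then writes there.\<close>

lemma stack_tape_push:
  assumes "stack_tape xs t"
  shows "stack_tape (x # xs)
    (tape_act (symbol (Some x), Stay) (tape_act (tape_read t, Go_Left) t))"
proof (cases t)
  case (Pair f h)
  have "f (h + (j - 1)) = cell xs (j - 1)" for j
    using assms Pair by (simp add: stack_tape_def)
  then show ?thesis
    using Pair by (auto simp: stack_tape_def cell_Cons algebra_simps)
qed

text \<open>The top is erased before the head moves right, since \<open>cell\<close> demands blanks
  on the left of the head. On an empty stack the head merely wanders over blanks, which matches
  \<open>tl [] = []\<close>.\<close>

lemma stack_tape_pop:
  assumes "stack_tape xs t"
  shows "stack_tape (tl xs)
    (let t' = tape_act (0, Stay) t in tape_act (tape_read t', Go_Right) t')"
proof (cases t)
  case (Pair f h)
  have f: "f (h + (j + 1)) = cell xs (j + 1)" for j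
    using assms Pair by (simp add: stack_tape_def)
  have "cell (tl xs) j = (if j = -1 then 0 else cell xs (j + 1))" for j
    by (cases xs) (auto simp: cell_Cons, auto simp: cell_def)
  then show ?thesis
    using Pair f by (auto simp: stack_tape_def Let_def algebra_simps)
qed

text \<open>Quantifying over all representing tapes abstracts from absolute head positions; as
  \<open>T\<close> is only an upper bound, time estimates can be weakened freely.\<close>

definition runs :: "prog \<Rightarrow> nat \<Rightarrow> (nat \<Rightarrow> letter list) \<Rightarrow> (nat \<Rightarrow> letter list) \<Rightarrow> bool" where
  "runs P T \<sigma> \<sigma>' \<longleftrightarrow> (\<forall>\<tau>. (\<forall>i. stack_tape (\<sigma> i) (\<tau> i)) \<longrightarrow>
     (\<exists>t\<le>T. \<exists>\<tau>'. halts P \<tau> t \<tau>' \<and> (\<forall>i. stack_tape (\<sigma>' i) (\<tau>' i))))"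

lemma runs_mono: "runs P T \<sigma> \<sigma>' \<Longrightarrow> T \<le> T' \<Longrightarrow> runs P T' \<sigma> \<sigma>'"
  unfolding runs_def by (meson le_trans)

lemma runs_Skip: "runs Skip 0 \<sigma> \<sigma>"
  by (auto simp: runs_def intro: halts_Skip)

lemma runs_Seq:
  assumes "runs P T \<sigma> \<sigma>'" and "runs Q T' \<sigma>' \<sigma>''"
  shows "runs (Seq P Q) (T + T' + 1) \<sigma> \<sigma>''"
  unfolding runs_def
proof (intro allI impI)
  fix \<tau> assume "\<forall>i. stack_tape (\<sigma> i) (\<tau> i)"
  then obtain t \<tau>' where 1: "t \<le> T" "halts P \<tau> t \<tau>'" "\<forall>i. stack_tape (\<sigma>' i) (\<tau>' i)"
    using assms(1) unfolding runs_def by blast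
  then obtain t' \<tau>'' where 2: "t' \<le> T'" "halts Q \<tau>' t' \<tau>''" "\<forall>i. stack_tape (\<sigma>'' i) (\<tau>'' i)"
    using assms(2) unfolding runs_def by blast
  show "\<exists>t\<le>T + T' + 1. \<exists>\<tau>'. halts (Seq P Q) \<tau> t \<tau>' \<and> (\<forall>i. stack_tape (\<sigma>'' i) (\<tau>' i))"
    using 1 2 halts_Seq[OF 1(2) 2(2)] by (intro exI[of _ "t + t' + 1"]) auto
qed

lemma runs_Branch:
  assumes "runs (if b (head (\<sigma> i)) (head (\<sigma> j)) then P else Q) T \<sigma> \<sigma>'"
  shows "runs (Branch i j b P Q) (Suc T) \<sigma> \<sigma>'"
  unfolding runs_def
proof (intro allI impI)
  fix \<tau> assume \<tau>: "\<forall>i. stack_tape (\<sigma> i) (\<tau> i)"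
  then obtain t \<tau>' where t: "t \<le> T" "\<forall>i. stack_tape (\<sigma>' i) (\<tau>' i)"
    "halts (if b (head (\<sigma> i)) (head (\<sigma> j)) then P else Q) \<tau> t \<tau>'"
    using assms unfolding runs_def by blast
  have "halts (Branch i j b P Q) \<tau> (Suc t) \<tau>'"
    by (rule halts_Branch) (use t(3) in \<open>simp add: unsymbol_tape_read[OF \<tau>]\<close>)
  with t show "\<exists>t\<le>Suc T. \<exists>\<tau>'. halts (Branch i j b P Q) \<tau> t \<tau>' \<and> (\<forall>i. stack_tape (\<sigma>' i) (\<tau>' i))"
    by (intro exI[of _ "Suc t"]) auto
qed

lemma runs_Loop_False: "\<not> b (head (\<sigma> i)) \<Longrightarrow> runs (Loop i b P) 1 \<sigma> \<sigma>"
  unfolding runs_def using halts_Loop_False unsymbol_tape_read by (metis order_refl)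

lemma runs_Loop_True:
  assumes "b (head (\<sigma> i))" and "runs P T \<sigma> \<sigma>'" and "runs (Loop i b P) T' \<sigma>' \<sigma>''"
  shows "runs (Loop i b P) (T + T' + 2) \<sigma> \<sigma>''"
  unfolding runs_def
proof (intro allI impI)
  fix \<tau> assume \<tau>: "\<forall>i. stack_tape (\<sigma> i) (\<tau> i)"
  then obtain t \<tau>' where 1: "t \<le> T" "halts P \<tau> t \<tau>'" "\<forall>i. stack_tape (\<sigma>' i) (\<tau>' i)"
    using assms(2) unfolding runs_def by blast
  then obtain t' \<tau>'' where 2: "t' \<le> T'" "halts (Loop i b P) \<tau>' t' \<tau>''"
    "\<forall>i. stack_tape (\<sigma>'' i) (\<tau>'' i)"
    using assms(3) unfolding runs_def by blast
  have "halts (Loop i b P) \<tau> (t + t' + 2) \<tau>''"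
    using halts_Loop_True[OF _ 1(2) 2(2)] assms(1) by (simp add: unsymbol_tape_read[OF \<tau>])
  then show "\<exists>t\<le>T + T' + 2. \<exists>\<tau>'. halts (Loop i b P) \<tau> t \<tau>' \<and> (\<forall>i. stack_tape (\<sigma>'' i) (\<tau>' i))"
    using 1 2 by (intro exI[of _ "t + t' + 2"]) auto
qed

section \<open>Stack operations and their running times\<close>

definition Push :: "nat \<Rightarrow> nat \<Rightarrow> (letter option \<Rightarrow> letter) \<Rightarrow> prog" where
  "Push i j g = Seq (Move i Go_Left) (Write i j (\<lambda>x. Some (g x)))"

definition Pop :: "nat \<Rightarrow> prog" where
  "Pop i = Seq (Write i i (\<lambda>_. None)) (Move i Go_Right)"

text \<open>Head \<open>i\<close> moves before the symbol of tape \<open>j\<close> is read, hence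
  \<open>i \<noteq> j\<close>. The time is two basic steps and one for passing between them.\<close>

lemma runs_Push:
  assumes "i \<noteq> j"
  shows "runs (Push i j g) 3 \<sigma> (\<sigma>(i := g (head (\<sigma> j)) # \<sigma> i))"
  unfolding runs_def
proof (intro allI impI)
  fix \<tau> assume \<tau>: "\<forall>i. stack_tape (\<sigma> i) (\<tau> i)"
  let ?\<tau> = "\<tau>(i := tape_act (tape_read (\<tau> i), Go_Left) (\<tau> i))"
  let ?\<tau>' = "?\<tau>(i := tape_act (symbol (Some (g (unsymbol (tape_read (?\<tau> j))))), Stay) (?\<tau> i))"
  have "halts (Push i j g) \<tau> 3 ?\<tau>'"
    unfolding Push_def using halts_Seq[OF halts_Move[of i Go_Left \<tau>] halts_Write[of i j "\<lambda>x. Some (g x)"]]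
    by (simp add: numeral_3_eq_3)
  moreover have "stack_tape ((\<sigma>(i := g (head (\<sigma> j)) # \<sigma> i)) k) (?\<tau>' k)" for k
    using assms \<tau> stack_tape_push by (simp add: unsymbol_tape_read[OF \<tau>])
  ultimately show "\<exists>t\<le>3. \<exists>\<tau>'. halts (Push i j g) \<tau> t \<tau>' \<and>
      (\<forall>k. stack_tape ((\<sigma>(i := g (head (\<sigma> j)) # \<sigma> i)) k) (\<tau>' k))"
    by blast
qed

lemma runs_Pop: "runs (Pop i) 3 \<sigma> (\<sigma>(i := tl (\<sigma> i)))"
  unfolding runs_def
proof (intro allI impI)
  fix \<tau> assume \<tau>: "\<forall>i. stack_tape (\<sigma> i) (\<tau> i)"
  let ?\<tau> = "\<tau>(i := tape_act (symbol None, Stay) (\<tau> i))"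
  let ?\<tau>' = "?\<tau>(i := tape_act (tape_read (?\<tau> i), Go_Right) (?\<tau> i))"
  have "halts (Pop i) \<tau> 3 ?\<tau>'"
    unfolding Pop_def using halts_Seq[OF halts_Write[of i i "\<lambda>_. None" \<tau>] halts_Move[of i Go_Right]]
    by (simp add: numeral_3_eq_3)
  moreover have "stack_tape ((\<sigma>(i := tl (\<sigma> i))) k) (?\<tau>' k)" for k
    using \<tau> stack_tape_pop[of "\<sigma> i" "\<tau> i"] by (simp add: Let_def)
  ultimately show "\<exists>t\<le>3. \<exists>\<tau>'. halts (Pop i) \<tau> t \<tau>' \<and>
      (\<forall>k. stack_tape ((\<sigma>(i := tl (\<sigma> i))) k) (\<tau>' k))"
    by blast
qed

definition Clear :: "nat \<Rightarrow> prog" where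
  "Clear i = Loop i (\<lambda>x. x \<noteq> None) (Pop i)"

text \<open>Each round costs 3 for \<open>Pop\<close> and 2 for unfolding the loop and discarding
  its finished body; the final 1 is the failing test. The constants of the other loops arise in the
  same way.\<close>

lemma runs_Clear: "runs (Clear i) (5 * length (\<sigma> i) + 1) \<sigma> (\<sigma>(i := []))"
proof (induction "\<sigma> i" arbitrary: \<sigma>)
  case Nil
  then show ?case
    using runs_Loop_False[of "\<lambda>x. x \<noteq> None" \<sigma> i] by (simp add: Clear_def fun_upd_idem)
next
  case (Cons x xs)
  then show ?case
    using runs_Loop_True[OF _ runs_Pop, of "\<lambda>x. x \<noteq> None" \<sigma> i i
        "5 * length xs + 1" "\<sigma>(i := [])"] Cons.hyps(1)[of "\<sigma>(i := xs)"]
    by (simp add: Clear_def Cons.hyps(2)[symmetric] add_ac)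
qed

definition Dump_while :: "(letter \<Rightarrow> bool) \<Rightarrow> nat \<Rightarrow> nat \<Rightarrow> prog" where
  "Dump_while p i j = Loop i (\<lambda>x. \<exists>a. x = Some a \<and> p a) (Seq (Push j i the) (Pop i))"

lemma runs_Dump_while:
  assumes "i \<noteq> j"
  shows "runs (Dump_while p i j) (9 * length (\<sigma> i) + 1) \<sigma>
    (\<sigma>(i := dropWhile p (\<sigma> i), j := rev (takeWhile p (\<sigma> i)) @ \<sigma> j))"
proof (induction "\<sigma> i" arbitrary: \<sigma>)
  case Nil
  then show ?case
    using runs_Loop_False[of "\<lambda>x. \<exists>a. x = Some a \<and> p a" \<sigma> i]
    by (simp add: Dump_while_def fun_upd_idem)
next
  case (Cons x xs)
  let ?b = "\<lambda>x. \<exists>a. x = Some a \<and> p a"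
  show ?case
  proof (cases "p x")
    case True
    let ?\<sigma> = "\<sigma>(i := xs, j := x # \<sigma> j)"
    let ?\<sigma>' = "\<sigma>(i := dropWhile p xs, j := rev (takeWhile p xs) @ x # \<sigma> j)"
    have "runs (Seq (Push j i the) (Pop i)) 7 \<sigma> ?\<sigma>"
      using runs_Seq[OF runs_Push[of j i "the" \<sigma>] runs_Pop[of i]] assms Cons.hyps(2)[symmetric]
      by (simp add: fun_upd_twist)
    moreover have "runs (Dump_while p i j) (9 * length xs + 1) ?\<sigma> ?\<sigma>'"
      using Cons.hyps(1)[of ?\<sigma>] assms by (simp add: fun_upd_twist)
    ultimately show ?thesis
      using runs_Loop_True[of ?b \<sigma> i _ 7 ?\<sigma> "9 * length xs + 1" ?\<sigma>'] True Cons.hyps(2)[symmetric]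
      by (simp add: Dump_while_def add_ac)
  next
    case False
    then show ?thesis
      using runs_mono[OF runs_Loop_False[of ?b \<sigma> i]] Cons.hyps(2)[symmetric]
      by (simp add: Dump_while_def fun_upd_idem)
  qed
qed

text \<open>Dumping a stack reverses it, so a detour over the auxiliary stack \<open>h\<close>
  restores the order.\<close>

definition Transfer :: "nat \<Rightarrow> nat \<Rightarrow> nat \<Rightarrow> prog" where
  "Transfer i j h = Seq (Dump_while (\<lambda>_. True) i h) (Dump_while (\<lambda>_. True) h j)"

lemma runs_Transfer:
  assumes "i \<noteq> j" "i \<noteq> h" "h \<noteq> j" and "\<sigma> j = []" "\<sigma> h = []"
  shows "runs (Transfer i j h) (18 * length (\<sigma> i) + 3) \<sigma> (\<sigma>(i := [], j := \<sigma> i))"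
proof -
  have "runs (Transfer i j h) (18 * length (\<sigma> i) + 3) \<sigma> (\<sigma>(i := [], h := [], j := \<sigma> i))"
    using runs_Seq[OF runs_Dump_while[of i h "\<lambda>_. True" \<sigma>] runs_Dump_while[of h j "\<lambda>_. True"]] assms
    by (simp add: Transfer_def takeWhile_eq_all_conv[THEN iffD2] dropWhile_eq_Nil_conv[THEN iffD2]
        fun_upd_twist numeral_3_eq_3)
  then show ?thesis
    using assms by (simp add: fun_upd_idem)
qed

text \<open>On the way back from the auxiliary stack \<open>h\<close> every letter goes to both
  \<open>i\<close> and \<open>j\<close>, which preserves the source.\<close>

definition Copy :: "nat \<Rightarrow> nat \<Rightarrow> nat \<Rightarrow> prog" where
  "Copy i j h = Seq (Dump_while (\<lambda>_. True) i h)
     (Loop h (\<lambda>x. x \<noteq> None) (Seq (Push i h the) (Seq (Push j h the) (Pop h))))"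

lemma runs_Copy:
  assumes "i \<noteq> j" "i \<noteq> h" "h \<noteq> j" and "\<sigma> j = []" "\<sigma> h = []"
  shows "runs (Copy i j h) (22 * length (\<sigma> i) + 3) \<sigma> (\<sigma>(j := \<sigma> i))"
proof -
  let ?P = "Seq (Push i h the) (Seq (Push j h the) (Pop h))"
  have *: "runs (Loop h (\<lambda>x. x \<noteq> None) ?P) (13 * length (\<sigma> h) + 1) \<sigma>
      (\<sigma>(h := [], i := rev (\<sigma> h) @ \<sigma> i, j := rev (\<sigma> h) @ \<sigma> j))" for \<sigma>
  proof (induction "\<sigma> h" arbitrary: \<sigma>)
    case Nil
    then show ?case
      using runs_Loop_False[of "\<lambda>x. x \<noteq> None" \<sigma> h] by (simp add: fun_upd_idem)
  next
    case (Cons x xs)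
    let ?\<sigma> = "\<sigma>(h := xs, i := x # \<sigma> i, j := x # \<sigma> j)"
    have "runs ?P 11 \<sigma> ?\<sigma>"
      using runs_Seq[OF runs_Push[of i h "the" \<sigma>]
          runs_Seq[OF runs_Push[of j h "the"] runs_Pop[of h]]]
        assms(1-3) Cons.hyps(2)[symmetric]
      by (simp add: fun_upd_twist)
    then show ?case
      using runs_Loop_True[of "\<lambda>x. x \<noteq> None" \<sigma> h ?P 11 ?\<sigma> "13 * length xs + 1"]
        Cons.hyps(1)[of ?\<sigma>]
        Cons.hyps(2)[symmetric] assms(1-3)
      by (simp add: fun_upd_twist add_ac)
  qed
  have "\<sigma>(h := [], i := \<sigma> i, j := \<sigma> i) = \<sigma>(j := \<sigma> i)"
    using assms by auto
  then show ?thesis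
    using runs_Seq[OF runs_Dump_while[of i h "\<lambda>_. True" \<sigma>] *] assms
    by (simp add: Copy_def takeWhile_eq_all_conv[THEN iffD2] dropWhile_eq_Nil_conv[THEN iffD2]
        fun_upd_twist numeral_3_eq_3)
qed

section \<open>A calculus of polynomial-time functions\<close>

definition polynomial :: "(nat \<Rightarrow> nat) \<Rightarrow> bool" where
  "polynomial T \<longleftrightarrow> (\<exists>Q. \<forall>x. T x = poly Q x)"

lemma polynomialI: "(\<And>x. T x = poly Q x) \<Longrightarrow> polynomial T"
  unfolding polynomial_def by blast

lemma polynomialE:
  assumes "polynomial T"
  obtains Q where "\<And>x. T x = poly Q x"
  using assms unfolding polynomial_def by blast

lemma polynomial_const: "polynomial (\<lambda>_. c)"
  by (rule polynomialI[of _ "[:c:]"]) simp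

lemma polynomial_id: "polynomial (\<lambda>x. x)"
  by (rule polynomialI[of _ "[:0, 1:]"]) simp

lemma polynomial_add: "polynomial S \<Longrightarrow> polynomial T \<Longrightarrow> polynomial (\<lambda>x. S x + T x)"
  by (elim polynomialE, rule polynomialI[of _ "_ + _"]) simp

lemma polynomial_mult: "polynomial S \<Longrightarrow> polynomial T \<Longrightarrow> polynomial (\<lambda>x. S x * T x)"
  by (elim polynomialE, rule polynomialI[of _ "_ * _"]) simp

lemma polynomial_compose: "polynomial S \<Longrightarrow> polynomial T \<Longrightarrow> polynomial (\<lambda>x. S (T x))"
  by (elim polynomialE, rule polynomialI[of _ "pcompose _ _"]) (simp add: poly_pcompose)

lemmas polynomial_intros = polynomial_const polynomial_id polynomial_add polynomial_mult

text \<open>The coefficients are natural numbers. Monotonicity is what allows actual input lengths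
  to be replaced by bounds inside time bounds.\<close>

lemma polynomial_mono:
  assumes "polynomial T" and "x \<le> y"
  shows "T x \<le> T y"
proof -
  have "poly Q x \<le> poly Q y" for Q :: "nat poly"
    using \<open>x \<le> y\<close> by (induction Q) (simp_all add: add_mono mult_mono)
  then show ?thesis using assms(1) by (simp add: polynomial_def) metis
qed

definition total_length :: "letter list list \<Rightarrow> nat" where
  "total_length e = (\<Sum>xs\<leftarrow>e. length xs)"

text \<open>
  The inputs may lie on any stacks below \<open>k\<close>, and the output goes to the first free stack \<open>k\<close>;
  thus programs can be composed without relocating them.
\<close>

definition computes :: "prog \<Rightarrow> (nat \<Rightarrow> nat) \<Rightarrow> nat \<Rightarrow> nat list \<Rightarrow> (letter list list \<Rightarrow> letter list) \<Rightarrow> bool"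
  where "computes P T k ix f \<longleftrightarrow> (\<forall>\<sigma>. (\<forall>j\<ge>k. \<sigma> j = []) \<longrightarrow>
     runs P (T (total_length (map \<sigma> ix))) \<sigma> (\<sigma>(k := f (map \<sigma> ix))))"

text \<open>One \<open>T\<close> bounds both the output length and the running time, uniformly in
  the placement of inputs and output. The length bound is what estimates the cost of programs that
  process this output further.\<close>

definition feasible_in :: "(nat \<Rightarrow> nat) \<Rightarrow> nat \<Rightarrow> (letter list list \<Rightarrow> letter list) \<Rightarrow> bool" where
  "feasible_in T n f \<longleftrightarrow> polynomial T \<and>
     (\<forall>e. length e = n \<longrightarrow> length (f e) \<le> T (total_length e)) \<and>
     (\<forall>k ix. length ix = n \<and> set ix \<subseteq> {..<k} \<longrightarrow> (\<exists>P. computes P T k ix f))"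

lemma feasible_inD:
  assumes "feasible_in T n f"
  shows "polynomial T" and "length e = n \<Longrightarrow> length (f e) \<le> T (total_length e)"
    and "length ix = n \<Longrightarrow> set ix \<subseteq> {..<k} \<Longrightarrow> \<exists>P. computes P T k ix f"
  using assms by (simp_all add: feasible_in_def)

definition feasible :: "nat \<Rightarrow> (letter list list \<Rightarrow> letter list) \<Rightarrow> bool" where
  "feasible n f \<longleftrightarrow> (\<exists>T. feasible_in T n f)"

lemma feasibleI:
  assumes "polynomial T" and "\<And>e. length e = n \<Longrightarrow> length (f e) \<le> T (total_length e)"
    and "\<And>k ix. length ix = n \<Longrightarrow> set ix \<subseteq> {..<k} \<Longrightarrow> \<exists>P. computes P T k ix f"
  shows "feasible n f"
  using assms unfolding feasible_def feasible_in_def by blast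

section \<open>Basic functions and case distinctions\<close>

lemma feasible_hd: "feasible (Suc n) (\<lambda>e. hd e)"
proof (rule feasibleI)
  show "polynomial (\<lambda>x. 22 * x + 3)" by (intro polynomial_intros)
  show "length (hd e) \<le> 22 * total_length e + 3" if "length e = Suc n" for e
    using that by (cases e) (auto simp: total_length_def)
  show "\<exists>P. computes P (\<lambda>x. 22 * x + 3) k ix hd" if ix: "length ix = Suc n" "set ix \<subseteq> {..<k}" for k ix
  proof -
    obtain i ix' where i: "ix = i # ix'" "i < k" using ix by (cases ix) auto
    have "runs (Copy i k (Suc k)) (22 * total_length (map \<sigma> ix) + 3) \<sigma> (\<sigma>(k := \<sigma> i))"
      if "\<forall>j\<ge>k. \<sigma> j = []" for \<sigma>
      by (rule runs_mono[OF runs_Copy]) (use that i in \<open>auto simp: total_length_def\<close>)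
    then show ?thesis unfolding computes_def using i by auto
  qed
qed

text \<open>Argument lists act as de Bruijn environments: \<open>hd\<close> is the variable bound
  last, and weakening drops it. The program stays the same and is only told to ignore the first
  input stack.\<close>

lemma feasible_wk:
  assumes "feasible n f"
  shows "feasible (Suc n) (\<lambda>e. f (tl e))"
proof -
  from assms obtain T where "feasible_in T n f" by (auto simp: feasible_def)
  note T = feasible_inD[OF this]
  have tl: "T (total_length (tl e)) \<le> T (total_length e)" for e
    by (rule polynomial_mono[OF T(1)]) (cases e; simp add: total_length_def)
  show ?thesis
  proof (rule feasibleI[OF T(1)])
    show "length (f (tl e)) \<le> T (total_length e)" if "length e = Suc n" for e
      using T(2)[of "tl e"] tl[of e] that by simp
    show "\<exists>P. computes P T k ix (\<lambda>e. f (tl e))" if ix: "length ix = Suc n" "set ix \<subseteq> {..<k}" for k ix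
    proof -
      have "set (tl ix) \<subseteq> {..<k}" using ix by (cases ix) auto
      then obtain P where P: "computes P T k (tl ix) f"
        using T(3)[of "tl ix" k] ix by auto
      have "computes P T k ix (\<lambda>e. f (tl e))"
        unfolding computes_def
      proof (intro allI impI)
        fix \<sigma> :: "nat \<Rightarrow> letter list" assume "\<forall>j\<ge>k. \<sigma> j = []"
        then have "runs P (T (total_length (tl (map \<sigma> ix)))) \<sigma> (\<sigma>(k := f (tl (map \<sigma> ix))))"
          using P by (simp add: computes_def map_tl)
        then show "runs P (T (total_length (map \<sigma> ix))) \<sigma> (\<sigma>(k := f (tl (map \<sigma> ix))))"
          using tl by (rule runs_mono)
      qed
      then show ?thesis ..
    qed
  qed
qed

lemma feasible_Nil: "feasible n (\<lambda>e. [])"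
proof (rule feasibleI[OF polynomial_const])
  show "length [] \<le> 0" by simp
  show "\<exists>P. computes P (\<lambda>_. 0) k ix (\<lambda>e. [])" for k ix
    unfolding computes_def using runs_Skip by (metis fun_upd_idem le_refl)
qed

lemma feasible_Cons:
  assumes "feasible n f"
  shows "feasible n (\<lambda>e. a # f e)"
proof -
  from assms obtain T where "feasible_in T n f" by (auto simp: feasible_def)
  note T = feasible_inD[OF this]
  show ?thesis
  proof (rule feasibleI)
    show "polynomial (\<lambda>x. T x + 4)" using T(1) by (intro polynomial_intros)
    show "length (a # f e) \<le> T (total_length e) + 4" if "length e = n" for e
      using T(2)[OF that] by simp
    show "\<exists>P. computes P (\<lambda>x. T x + 4) k ix (\<lambda>e. a # f e)"
      if ix: "length ix = n" "set ix \<subseteq> {..<k}" for k ix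
    proof -
      obtain P where P: "computes P T k ix f" using T(3)[OF ix] by blast
      have "computes (Seq P (Push k (Suc k) (\<lambda>_. a))) (\<lambda>x. T x + 4) k ix (\<lambda>e. a # f e)"
        unfolding computes_def
      proof (intro allI impI)
        fix \<sigma> :: "nat \<Rightarrow> letter list" assume "\<forall>j\<ge>k. \<sigma> j = []"
        then have "runs P (T (total_length (map \<sigma> ix))) \<sigma> (\<sigma>(k := f (map \<sigma> ix)))"
          using P by (simp add: computes_def)
        from runs_Seq[OF this runs_Push[of k "Suc k" "\<lambda>_. a"]]
        show "runs (Seq P (Push k (Suc k) (\<lambda>_. a))) (T (total_length (map \<sigma> ix)) + 4) \<sigma>
            (\<sigma>(k := a # f (map \<sigma> ix)))" by (simp add: add.commute)
      qed
      then show ?thesis ..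
    qed
  qed
qed

lemma feasible_tl:
  assumes "feasible n f"
  shows "feasible n (\<lambda>e. tl (f e))"
proof -
  from assms obtain T where "feasible_in T n f" by (auto simp: feasible_def)
  note T = feasible_inD[OF this]
  show ?thesis
  proof (rule feasibleI)
    show "polynomial (\<lambda>x. T x + 4)" using T(1) by (intro polynomial_intros)
    show "length (tl (f e)) \<le> T (total_length e) + 4" if "length e = n" for e
      using T(2)[OF that] by simp
    show "\<exists>P. computes P (\<lambda>x. T x + 4) k ix (\<lambda>e. tl (f e))"
      if ix: "length ix = n" "set ix \<subseteq> {..<k}" for k ix
    proof -
      obtain P where P: "computes P T k ix f" using T(3)[OF ix] by blast
      have "computes (Seq P (Pop k)) (\<lambda>x. T x + 4) k ix (\<lambda>e. tl (f e))"
        unfolding computes_def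
      proof (intro allI impI)
        fix \<sigma> :: "nat \<Rightarrow> letter list" assume "\<forall>j\<ge>k. \<sigma> j = []"
        then have "runs P (T (total_length (map \<sigma> ix))) \<sigma> (\<sigma>(k := f (map \<sigma> ix)))"
          using P by (simp add: computes_def)
        from runs_Seq[OF this runs_Pop[of k]]
        show "runs (Seq P (Pop k)) (T (total_length (map \<sigma> ix)) + 4) \<sigma>
            (\<sigma>(k := tl (f (map \<sigma> ix))))" by (simp add: add.commute)
      qed
      then show ?thesis ..
    qed
  qed
qed

lemma feasible_takeWhile:
  assumes "feasible n f"
  shows "feasible n (\<lambda>e. takeWhile p (f e))"
proof -
  from assms obtain T where "feasible_in T n f" by (auto simp: feasible_def)
  note T = feasible_inD[OF this]
  show ?thesis
  proof (rule feasibleI)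
    show "polynomial (\<lambda>x. T x + 23 * T x + 6)"
      using T(1) by (intro polynomial_intros)
    have le: "length (takeWhile p xs) \<le> length xs" for xs :: "letter list"
      by (rule length_takeWhile_le)
    show "length (takeWhile p (f e)) \<le> T (total_length e) + 23 * T (total_length e) + 6" if "length e = n" for e
      using T(2)[OF that] le[of "f e"] by simp
    show "\<exists>P. computes P (\<lambda>x. T x + 23 * T x + 6) k ix (\<lambda>e. takeWhile p (f e))"
      if ix: "length ix = n" "set ix \<subseteq> {..<k}" for k ix
    proof -
      obtain P where P: "computes P T k ix f" using T(3)[OF ix] by blast
      \<comment> \<open>Park the prefix, reversed, on the auxiliary stack, delete the rest, and dump
        the prefix back. The three loops contribute 9 + 5 + 9 = 23 per letter.\<close>
      let ?Q = "Seq P (Seq (Dump_while p k (Suc k)) (Seq (Clear k) (Dump_while (\<lambda>_. True) (Suc k) k)))"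
      have "computes ?Q (\<lambda>x. T x + 23 * T x + 6) k ix (\<lambda>e. takeWhile p (f e))"
        unfolding computes_def
      proof (intro allI impI)
        fix \<sigma> :: "nat \<Rightarrow> letter list" assume \<sigma>: "\<forall>j\<ge>k. \<sigma> j = []"
        let ?t = "T (total_length (map \<sigma> ix))" and ?y = "f (map \<sigma> ix)"
        let ?w = "takeWhile p ?y" and ?d = "dropWhile p ?y"
        have 1: "runs P ?t \<sigma> (\<sigma>(k := ?y))" using P \<sigma> by (simp add: computes_def)
        have 2: "runs (Dump_while p k (Suc k)) (9 * length ?y + 1) (\<sigma>(k := ?y))
            (\<sigma>(k := ?d, Suc k := rev ?w))"
          using runs_Dump_while[of k "Suc k" p "\<sigma>(k := ?y)"] \<sigma> by simp
        have 3: "runs (Clear k) (5 * length ?d + 1) (\<sigma>(k := ?d, Suc k := rev ?w))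
            (\<sigma>(k := [], Suc k := rev ?w))"
          using runs_Clear[of k "\<sigma>(k := ?d, Suc k := rev ?w)"] by (simp add: fun_upd_twist)
        have *: "\<sigma>(Suc k := [], k := ?w) = \<sigma>(k := ?w)" using \<sigma> by (auto simp: fun_eq_iff)
        have 4: "runs (Dump_while (\<lambda>_. True) (Suc k) k) (9 * length ?w + 1)
            (\<sigma>(k := [], Suc k := rev ?w)) (\<sigma>(k := ?w))"
          using runs_Dump_while[of "Suc k" k "\<lambda>_. True" "\<sigma>(k := [], Suc k := rev ?w)"] *
          by (simp add: takeWhile_eq_all_conv[THEN iffD2] dropWhile_eq_Nil_conv[THEN iffD2]
              fun_upd_twist)
        have "length ?y \<le> ?t" using T(2)[of "map \<sigma> ix"] ix by simp
        moreover have "length ?w \<le> length ?y" "length ?d \<le> length ?y"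
          by (rule le) (rule length_dropWhile_le)
        ultimately show "runs ?Q (?t + 23 * ?t + 6) \<sigma> (\<sigma>(k := ?w))"
          by (intro runs_mono[OF runs_Seq[OF 1 runs_Seq[OF 2 runs_Seq[OF 3 4]]]]) linarith
      qed
      then show ?thesis ..
    qed
  qed
qed

lemma feasible_if:
  assumes "feasible n f" and "feasible n g" and "feasible n h" and "feasible n h'"
  shows "feasible n (\<lambda>e. if b (head (f e)) (head (g e)) then h e else h' e)"
proof -
  obtain T\<^sub>1 where "feasible_in T\<^sub>1 n f" using assms(1) by (auto simp: feasible_def)
  note T1 = feasible_inD[OF this]
  obtain T\<^sub>2 where "feasible_in T\<^sub>2 n g" using assms(2) by (auto simp: feasible_def)
  note T2 = feasible_inD[OF this]
  obtain T\<^sub>3 where "feasible_in T\<^sub>3 n h" using assms(3) by (auto simp: feasible_def)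
  note T3 = feasible_inD[OF this]
  obtain T\<^sub>4 where "feasible_in T\<^sub>4 n h'" using assms(4) by (auto simp: feasible_def)
  note T4 = feasible_inD[OF this]
  define T where "T = (\<lambda>x. 6 * T\<^sub>1 x + 6 * T\<^sub>2 x + T\<^sub>3 x + T\<^sub>4 x + 7)"
  show ?thesis
  proof (rule feasibleI)
    show "polynomial T"
      unfolding T_def using T1(1) T2(1) T3(1) T4(1)
      by (intro polynomial_intros)
    show "length (if b (head (f e)) (head (g e)) then h e else h' e) \<le> T (total_length e)"
      if "length e = n" for e
      using T3(2)[OF that] T4(2)[OF that] by (simp add: T_def)
    show "\<exists>P. computes P T k ix (\<lambda>e. if b (head (f e)) (head (g e)) then h e else h' e)"
      if ix: "length ix = n" "set ix \<subseteq> {..<k}" for k ix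
    proof -
      have ix': "set ix \<subseteq> {..<Suc k}" using ix(2) by auto
      obtain P\<^sub>1 where P1: "computes P\<^sub>1 T\<^sub>1 k ix f" using T1(3)[OF ix] by blast
      obtain P\<^sub>2 where P2: "computes P\<^sub>2 T\<^sub>2 (Suc k) ix g" using T2(3)[OF ix(1) ix'] by blast
      obtain P\<^sub>3 where P3: "computes P\<^sub>3 T\<^sub>3 k ix h" using T3(3)[OF ix] by blast
      obtain P\<^sub>4 where P4: "computes P\<^sub>4 T\<^sub>4 k ix h'" using T4(3)[OF ix] by blast
      \<comment> \<open>Both test results are deleted before the chosen branch starts, so that it
        finds stack \<open>k\<close> free again for its own output.\<close>
      let ?R = "\<lambda>P. Seq (Clear (Suc k)) (Seq (Clear k) P)"
      let ?Q = "Seq P\<^sub>1 (Seq P\<^sub>2 (Branch k (Suc k) b (?R P\<^sub>3) (?R P\<^sub>4)))"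
      have "computes ?Q T k ix (\<lambda>e. if b (head (f e)) (head (g e)) then h e else h' e)"
        unfolding computes_def
      proof (intro allI impI)
        fix \<sigma> :: "nat \<Rightarrow> letter list" assume \<sigma>: "\<forall>j\<ge>k. \<sigma> j = []"
        let ?s = "total_length (map \<sigma> ix)" and ?e = "map \<sigma> ix"
        let ?\<sigma> = "\<sigma>(k := f ?e, Suc k := g ?e)"
        have 1: "runs P\<^sub>1 (T\<^sub>1 ?s) \<sigma> (\<sigma>(k := f ?e))" using P1 \<sigma> by (simp add: computes_def)
        have map: "map (\<sigma>(k := f ?e)) ix = ?e" using ix(2) by auto
        have 2: "runs P\<^sub>2 (T\<^sub>2 ?s) (\<sigma>(k := f ?e)) ?\<sigma>"
          using P2[unfolded computes_def, rule_format, of "\<sigma>(k := f ?e)"] \<sigma>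
          by (simp add: map del: map_eq_conv)
        have 3: "runs (Clear (Suc k)) (5 * length (g ?e) + 1) ?\<sigma> (\<sigma>(k := f ?e))"
          using runs_Clear[of "Suc k" ?\<sigma>] \<sigma> by (simp add: fun_upd_idem)
        have 4: "runs (Clear k) (5 * length (f ?e) + 1) (\<sigma>(k := f ?e)) \<sigma>"
          using runs_Clear[of k "\<sigma>(k := f ?e)"] \<sigma> by (simp add: fun_upd_idem)
        have R: "runs (?R P) (5 * length (g ?e) + 1 + (5 * length (f ?e) + 1 + t + 1) + 1) ?\<sigma> \<sigma>'"
          if "runs P t \<sigma> \<sigma>'" for P t \<sigma>'
          using runs_Seq[OF 3 runs_Seq[OF 4 that]] .
        have P34: "runs P\<^sub>3 (T\<^sub>3 ?s) \<sigma> (\<sigma>(k := h ?e))" "runs P\<^sub>4 (T\<^sub>4 ?s) \<sigma> (\<sigma>(k := h' ?e))"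
          using P3 P4 \<sigma> by (simp_all add: computes_def)
        let ?t = "5 * length (g ?e) + 1 + (5 * length (f ?e) + 1 + (T\<^sub>3 ?s + T\<^sub>4 ?s) + 1) + 1"
        have 5: "runs (Branch k (Suc k) b (?R P\<^sub>3) (?R P\<^sub>4)) (Suc ?t) ?\<sigma>
            (\<sigma>(k := if b (head (f ?e)) (head (g ?e)) then h ?e else h' ?e))"
          by (rule runs_Branch)
            (use runs_mono[OF R[OF P34(1)], of ?t] runs_mono[OF R[OF P34(2)], of ?t] in simp)
        have "length (f ?e) \<le> T\<^sub>1 ?s" "length (g ?e) \<le> T\<^sub>2 ?s"
          using T1(2)[of ?e] T2(2)[of ?e] ix by simp_all
        then show "runs ?Q (T ?s) \<sigma>
            (\<sigma>(k := if b (head (f ?e)) (head (g ?e)) then h ?e else h' ?e))"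
          by (intro runs_mono[OF runs_Seq[OF 1 runs_Seq[OF 2 5]]]) (simp add: T_def)
      qed
      then show ?thesis ..
    qed
  qed
qed

lemma feasible_if_head:
  assumes "feasible n f" and "feasible n h" and "feasible n h'"
  shows "feasible n (\<lambda>e. if head (f e) = a then h e else h' e)"
  using feasible_if[OF assms(1) assms(1) assms(2,3), of "\<lambda>x y. x = a"] .

text \<open>Transports one letter between words. As \<open>feasible_Cons\<close> only adds a fixed
  letter, it is computed by a case distinction over the four letters.\<close>

definition cons_head :: "letter list \<Rightarrow> letter list \<Rightarrow> letter list" where
  "cons_head xs ys = (case xs of [] \<Rightarrow> ys | x # _ \<Rightarrow> x # ys)"

lemma feasible_cons_head:
  assumes "feasible n f" and "feasible n g"
  shows "feasible n (\<lambda>e. cons_head (f e) (g e))"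
proof -
  let ?F = "\<lambda>e. if head (f e) = Some (Bit False) then Bit False # g e
      else if head (f e) = Some (Bit True) then Bit True # g e
      else if head (f e) = Some Comma then Comma # g e
      else if head (f e) = Some Semicolon then Semicolon # g e else g e"
  have "feasible n ?F"
    by (intro feasible_if_head feasible_Cons assms)
  moreover have "?F e = cons_head (f e) (g e)" for e
    by (cases "head (f e)" rule: symbol.cases; cases "f e") (auto simp: cons_head_def)
  ultimately show ?thesis by simp
qed

section \<open>Recursion over the tails of a word\<close>

fun fold_tails :: "(letter list \<Rightarrow> letter list \<Rightarrow> letter list) \<Rightarrow> letter list \<Rightarrow> letter list \<Rightarrow> letter list"
  where
    "fold_tails g [] a = a"
  | "fold_tails g (x # xs) a = fold_tails g xs (g (x # xs) a)"

lemma length_fold_tails: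
  assumes "\<And>s a. length s \<le> L \<Longrightarrow> length (g s a) \<le> length a + r" and "length xs \<le> L"
  shows "length (fold_tails g xs a) \<le> length a + length xs * r"
  using assms(2)
proof (induction xs arbitrary: a)
  case (Cons x xs)
  have "length (fold_tails g xs (g (x # xs) a)) \<le> length (g (x # xs) a) + length xs * r"
    using Cons by simp
  also have "length (g (x # xs) a) \<le> length a + r" using assms(1)[of "x # xs" a] Cons.prems by simp
  finally show ?case by simp
qed simp

text \<open>A form of bounded recursion on notation in the spirit of Cobham. The increment
  \<open>R\<close> does not depend on the accumulator \<open>a\<close>, so after all rounds the
  accumulator has grown by at most the word length times one polynomial quantity.\<close>

lemma feasible_fold_tails:
  assumes "feasible n f" and "feasible n c"
    and "feasible (Suc (Suc n)) (\<lambda>e. h (tl (tl e)) (hd (tl e)) (hd e))"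
    and "polynomial R"
    and "\<And>e s a. length e = n \<Longrightarrow> length (h e s a) \<le> length a + R (length s + total_length e)"
  shows "feasible n (\<lambda>e. fold_tails (h e) (f e) (c e))"
proof -
  obtain T\<^sub>1 where "feasible_in T\<^sub>1 n f" using assms(1) by (auto simp: feasible_def)
  note T1 = feasible_inD[OF this]
  obtain T\<^sub>2 where "feasible_in T\<^sub>2 n c" using assms(2) by (auto simp: feasible_def)
  note T2 = feasible_inD[OF this]
  obtain T\<^sub>3 where
    "feasible_in T\<^sub>3 (Suc (Suc n)) (\<lambda>e. h (tl (tl e)) (hd (tl e)) (hd e))"
    using assms(3) by (auto simp: feasible_def)
  note T3 = feasible_inD[OF this]
  \<comment> \<open>\<open>A\<close> bounds the accumulator at all times, \<open>I\<close> the time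
    of one round and \<open>T\<close> the whole program. In \<open>I\<close>, the step function
    receives a rest of the word, the accumulator and the environment, whence the argument of
    \<open>T\<^sub>3\<close>.\<close>
  define A where "A = (\<lambda>x. T\<^sub>2 x + T\<^sub>1 x * R (T\<^sub>1 x + x))"
  define I where "I = (\<lambda>x. T\<^sub>3 (T\<^sub>1 x + (A x + x)) + 23 * A x + 10)"
  define T where "T = (\<lambda>x. T\<^sub>1 x + T\<^sub>2 x + T\<^sub>1 x * (I x + 2) + 18 * A x + 7)"
  have "polynomial A" unfolding A_def using T1(1) T2(1) assms(4)
    by (intro polynomial_intros polynomial_compose[OF assms(4)])
  moreover from this have "polynomial I" unfolding I_def using T1(1) T3(1)
    by (intro polynomial_intros polynomial_compose[OF T3(1)])
  ultimately have T: "polynomial T" unfolding T_def using T1(1) T2(1)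
    by (intro polynomial_intros)
  have h: "length (h e s a) \<le> length a + R (T\<^sub>1 (total_length e) + total_length e)"
    if "length e = n" "length s \<le> T\<^sub>1 (total_length e)" for e s a
    using assms(5)[OF that(1), of s a] that(2)
      polynomial_mono[OF assms(4), of "length s + total_length e" "T\<^sub>1 (total_length e) + total_length e"] by simp
  have fold: "length (fold_tails (h e) (f e) (c e)) \<le> A (total_length e)" if e: "length e = n" for e
  proof -
    have "length (fold_tails (h e) (f e) (c e))
        \<le> length (c e) + length (f e) * R (T\<^sub>1 (total_length e) + total_length e)"
      using length_fold_tails[of "T\<^sub>1 (total_length e)" "h e", OF h[OF e]] T1(2)[OF e] by simp
    also have "\<dots> \<le> A (total_length e)" unfolding A_def
      using T1(2)[OF e] T2(2)[OF e] by (intro add_mono mult_right_mono) auto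
    finally show ?thesis .
  qed
  show ?thesis
  proof (rule feasibleI[OF T])
    show "length (fold_tails (h e) (f e) (c e)) \<le> T (total_length e)" if "length e = n" for e
      using fold[OF that] by (simp add: T_def)
    show "\<exists>P. computes P T k ix (\<lambda>e. fold_tails (h e) (f e) (c e))"
      if ix: "length ix = n" "set ix \<subseteq> {..<k}" for k ix
    proof -
      have "set ix \<subseteq> {..<Suc k}" using ix(2) by auto
      then obtain P\<^sub>2 where P2: "computes P\<^sub>2 T\<^sub>2 (Suc k) ix c" using T2(3)[OF ix(1)] by blast
      obtain P\<^sub>1 where P1: "computes P\<^sub>1 T\<^sub>1 k ix f" using T1(3)[OF ix] by blast
      have "set (Suc k # k # ix) \<subseteq> {..<Suc (Suc k)}" using ix(2) by auto
      then obtain P\<^sub>3 where P3: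
        "computes P\<^sub>3 T\<^sub>3 (Suc (Suc k)) (Suc k # k # ix) (\<lambda>e. h (tl (tl e)) (hd (tl e)) (hd e))"
        using T3(3)[of "Suc k # k # ix" "Suc (Suc k)"] ix(1) by auto
      \<comment> \<open>Stack \<open>k\<close> holds the rest of the word, \<open>Suc k\<close> the
        accumulator and the next one the result of the step; the result replaces the accumulator by
        way of one further auxiliary stack.\<close>
      define B where "B = Seq P\<^sub>3 (Seq (Clear (Suc k))
        (Seq (Transfer (Suc (Suc k)) (Suc k) (Suc (Suc (Suc k)))) (Pop k)))"
      let ?W = "Loop k (\<lambda>x. x \<noteq> None) B"
      let ?Q = "Seq P\<^sub>1 (Seq P\<^sub>2 (Seq ?W (Transfer (Suc k) k (Suc (Suc k)))))"
      have "computes ?Q T k ix (\<lambda>e. fold_tails (h e) (f e) (c e))"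
        unfolding computes_def
      proof (intro allI impI)
        fix \<sigma> :: "nat \<Rightarrow> letter list" assume \<sigma>: "\<forall>j\<ge>k. \<sigma> j = []"
        define e where "e = map \<sigma> ix"
        define z where "z = total_length e"
        have e: "length e = n" using ix by (simp add: e_def)
        have B: "runs B (I z) (\<sigma>(k := s, Suc k := a)) (\<sigma>(k := tl s, Suc k := h e s a))"
          if s: "length s \<le> T\<^sub>1 z" and a: "length a \<le> A z" and ha: "length (h e s a) \<le> A z" for s a
        proof -
          let ?y = "h e s a"
          let ?\<sigma> = "\<sigma>(k := s, Suc k := a)"
          have map: "map ?\<sigma> (Suc k # k # ix) = a # s # e" using ix(2) by (auto simp: e_def)
          have "total_length (a # s # e) \<le> T\<^sub>1 z + (A z + z)" using s a by (simp add: total_length_def z_def)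
          then have le: "T\<^sub>3 (total_length (a # s # e)) \<le> T\<^sub>3 (T\<^sub>1 z + (A z + z))"
            by (rule polynomial_mono[OF T3(1)])
          have "runs P\<^sub>3 (T\<^sub>3 (total_length (a # s # e))) ?\<sigma> (?\<sigma>(Suc (Suc k) := ?y))"
            using P3[unfolded computes_def, rule_format, of ?\<sigma>] \<sigma>
            unfolding map by simp
          then have 1: "runs P\<^sub>3 (T\<^sub>3 (T\<^sub>1 z + (A z + z))) ?\<sigma> (?\<sigma>(Suc (Suc k) := ?y))"
            using le by (rule runs_mono)
          have 2: "runs (Clear (Suc k)) (5 * length a + 1) (?\<sigma>(Suc (Suc k) := ?y))
              (\<sigma>(k := s, Suc (Suc k) := ?y))"
            using runs_Clear[of "Suc k" "?\<sigma>(Suc (Suc k) := ?y)"] \<sigma>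
            by (simp add: fun_upd_twist fun_upd_idem)
          have "\<sigma>(k := s, Suc (Suc k) := [], Suc k := ?y) = \<sigma>(k := s, Suc k := ?y)"
            using \<sigma> by (auto simp: fun_eq_iff)
          then have 3: "runs (Transfer (Suc (Suc k)) (Suc k) (Suc (Suc (Suc k)))) (18 * length ?y + 3)
              (\<sigma>(k := s, Suc (Suc k) := ?y)) (\<sigma>(k := s, Suc k := ?y))"
            using runs_Transfer[of "Suc (Suc k)" "Suc k" "Suc (Suc (Suc k))"
                "\<sigma>(k := s, Suc (Suc k) := ?y)"] \<sigma> by simp
          have 4: "runs (Pop k) 3 (\<sigma>(k := s, Suc k := ?y)) (\<sigma>(k := tl s, Suc k := ?y))"
            using runs_Pop[of k "\<sigma>(k := s, Suc k := ?y)"] by (simp add: fun_upd_twist)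
          show ?thesis unfolding B_def
            by (rule runs_mono[OF runs_Seq[OF 1 runs_Seq[OF 2 runs_Seq[OF 3 4]]]])
              (use a ha in \<open>simp add: I_def\<close>)
        qed
        define r where "r = R (T\<^sub>1 z + z)"
        define st where "st s a = \<sigma>(k := s, Suc k := a)" for s a
        have st: "st [] a = \<sigma>(Suc k := a)" "st s a k = s" for s a
          using \<sigma> by (auto simp: st_def fun_eq_iff)
        \<comment> \<open>The second premise is a budget for the rounds still to come: each round
          consumes one letter and adds at most \<open>r\<close>, so the premise is preserved and
          keeps the accumulator below \<open>A z\<close>.\<close>
        have W: "runs ?W (length s * (I z + 2) + 1) (st s a) (st [] (fold_tails (h e) s a))"
          if "length s \<le> T\<^sub>1 z" "length a + length s * r \<le> A z" for s a
          using that
        proof (induction s arbitrary: a)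
          case Nil
          have *: "runs ?W 1 (st [] a) (st [] a)"
            using runs_Loop_False[of "\<lambda>x. x \<noteq> None" "st [] a" k B] by (simp add: st(2))
          show ?case
            using * by simp
        next
          case (Cons x s)
          have ha: "length (h e (x # s) a) \<le> length a + r"
            using h[OF e, of "x # s" a] Cons.prems(1) by (simp add: r_def z_def)
          have 1: "runs B (I z) (st (x # s) a) (st s (h e (x # s) a))"
            using B[of "x # s" a] Cons.prems ha by (simp add: st_def)
          have 2: "runs ?W (length s * (I z + 2) + 1) (st s (h e (x # s) a))
              (st [] (fold_tails (h e) (x # s) a))"
            using Cons.IH[of "h e (x # s) a"] Cons.prems ha by simp
          show ?case
            by (rule runs_mono[OF runs_Loop_True[OF _ 1 2]]) (simp_all add: st(2))
        qed
        have fe: "length (f e) \<le> T\<^sub>1 z" and ce: "length (c e) \<le> T\<^sub>2 z"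
          using T1(2)[OF e] T2(2)[OF e] by (simp_all add: z_def)
        have 1: "runs P\<^sub>1 (T\<^sub>1 z) \<sigma> (\<sigma>(k := f e))"
          using P1 \<sigma> by (simp add: computes_def e_def z_def)
        have "map (\<sigma>(k := f e)) ix = e" using ix(2) by (auto simp: e_def)
        then have 2: "runs P\<^sub>2 (T\<^sub>2 z) (\<sigma>(k := f e)) (\<sigma>(k := f e, Suc k := c e))"
          using P2[unfolded computes_def, rule_format, of "\<sigma>(k := f e)"] \<sigma> by (simp add: z_def)
        let ?y = "fold_tails (h e) (f e) (c e)"
        have 3: "runs ?W (length (f e) * (I z + 2) + 1) (\<sigma>(k := f e, Suc k := c e))
            (\<sigma>(Suc k := ?y))"
          unfolding st(1)[symmetric] st_def[symmetric]
          using fe ce by (intro W) (auto simp: A_def r_def intro!: add_mono mult_right_mono)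
        have "\<sigma>(Suc k := [], k := ?y) = \<sigma>(k := ?y)" using \<sigma> by (auto simp: fun_eq_iff)
        then have 4: "runs (Transfer (Suc k) k (Suc (Suc k))) (18 * length ?y + 3)
            (\<sigma>(Suc k := ?y)) (\<sigma>(k := ?y))"
          using runs_Transfer[of "Suc k" k "Suc (Suc k)" "\<sigma>(Suc k := ?y)"] \<sigma> by simp
        have "length (f e) * (I z + 2) \<le> T\<^sub>1 z * (I z + 2)" using fe by (intro mult_right_mono) auto
        moreover have "length ?y \<le> A z" using fold[OF e] by (simp add: z_def)
        ultimately have "runs ?Q (T z) \<sigma> (\<sigma>(k := ?y))"
          by (intro runs_mono[OF runs_Seq[OF 1 runs_Seq[OF 2 runs_Seq[OF 3 4]]]])
            (unfold T_def, linarith)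
        then show "runs ?Q (T (total_length (map \<sigma> ix))) \<sigma>
            (\<sigma>(k := fold_tails (h (map \<sigma> ix)) (f (map \<sigma> ix)) (c (map \<sigma> ix))))"
          by (simp add: z_def e_def)
      qed
      then show ?thesis ..
    qed
  qed
qed

section \<open>Predicates, unary arithmetic and bounded quantifiers\<close>

named_theorems feasible_intros

text \<open>Truth is a nonempty word, in agreement with the acceptance convention of
  \<open>prog_tm\<close>.\<close>

definition checkable :: "nat \<Rightarrow> (letter list list \<Rightarrow> bool) \<Rightarrow> bool" where
  "checkable n Q \<longleftrightarrow> feasible n (\<lambda>e. if Q e then [Comma] else [])"

lemma checkable_head_eq [feasible_intros]: "feasible n f \<Longrightarrow> checkable n (\<lambda>e. head (f e) = a)"
  unfolding checkable_def by (intro feasible_if_head feasible_Cons feasible_Nil)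

lemma feasible_cond [feasible_intros]:
  assumes "checkable n Q" and "feasible n f" and "feasible n g"
  shows "feasible n (\<lambda>e. if Q e then f e else g e)"
proof -
  have "(\<lambda>e. if Q e then f e else g e)
      = (\<lambda>e. if head (if Q e then [Comma] else []) = None then g e else f e)"
    by auto
  then show ?thesis using feasible_if_head[OF assms(1)[unfolded checkable_def] assms(3,2), of None]
    by simp
qed

lemma checkable_not [feasible_intros]:
  assumes "checkable n Q" shows "checkable n (\<lambda>e. \<not> Q e)"
proof -
  have "(\<lambda>e. if \<not> Q e then [Comma] else []) = (\<lambda>e. if Q e then [] else [Comma])" by auto
  then show ?thesis unfolding checkable_def
    using feasible_cond[OF assms feasible_Nil feasible_Cons[OF feasible_Nil], of Comma] by simp
qed

lemma checkable_conj [feasible_intros]: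
  assumes "checkable n Q" and "checkable n R" shows "checkable n (\<lambda>e. Q e \<and> R e)"
proof -
  have "(\<lambda>e. if Q e \<and> R e then [Comma] else [])
      = (\<lambda>e. if Q e then if R e then [Comma] else [] else [])" by auto
  then show ?thesis using feasible_cond[OF assms(1) assms(2)[unfolded checkable_def] feasible_Nil]
    by (simp add: checkable_def)
qed

lemma checkable_imp [feasible_intros]:
  assumes "checkable n Q" and "checkable n R" shows "checkable n (\<lambda>e. Q e \<longrightarrow> R e)"
  using checkable_not[OF checkable_conj[OF assms(1) checkable_not[OF assms(2)]]] by simp

lemma feasible_wk2: "feasible n f \<Longrightarrow> feasible (Suc (Suc n)) (\<lambda>e. f (tl (tl e)))"
  using feasible_wk[OF feasible_wk, of n f] .

lemma fold_tails_cons_head: "fold_tails cons_head xs a = rev xs @ a"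
  by (induction xs arbitrary: a) (auto simp: cons_head_def)

text \<open>Folding \<open>cons_head\<close> moves the letters one by one and thereby reverses them.
  An empty second word gives reversal, and reversing beforehand gives concatenation.\<close>

lemma feasible_fold_cons_head:
  assumes "feasible n f" and "feasible n g"
  shows "feasible n (\<lambda>e. rev (f e) @ g e)"
proof -
  have "feasible (Suc (Suc n)) (\<lambda>e. cons_head (hd (tl e)) (hd e))"
    by (intro feasible_cons_head feasible_hd feasible_wk)
  then have "feasible n (\<lambda>e. fold_tails cons_head (f e) (g e))"
    by (rule feasible_fold_tails[OF assms _ polynomial_const[of 1]])
      (simp add: cons_head_def split: list.split)
  then show ?thesis by (simp add: fold_tails_cons_head)
qed

lemma feasible_rev [feasible_intros]: "feasible n f \<Longrightarrow> feasible n (\<lambda>e. rev (f e))"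
  using feasible_fold_cons_head[OF _ feasible_Nil] by simp

lemma feasible_append [feasible_intros]:
  "feasible n f \<Longrightarrow> feasible n g \<Longrightarrow> feasible n (\<lambda>e. f e @ g e)"
  using feasible_fold_cons_head[OF feasible_rev] by simp

lemma fold_tails_tl: "fold_tails (\<lambda>s a. tl a) xs a = drop (length xs) a"
  by (induction xs arbitrary: a) (auto simp: drop_Suc)

text \<open>On unary numbers this is truncated subtraction, hence also the test for
  \<open>\<le>\<close>.\<close>

lemma feasible_drop [feasible_intros]:
  assumes "feasible n f" and "feasible n g"
  shows "feasible n (\<lambda>e. drop (length (f e)) (g e))"
proof -
  have "feasible (Suc (Suc n)) (\<lambda>e. tl (hd e))"
    by (intro feasible_tl feasible_hd)
  then have "feasible n (\<lambda>e. fold_tails (\<lambda>s a. tl a) (f e) (g e))"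
    by (rule feasible_fold_tails[OF assms _ polynomial_const[of 0]]) simp
  then show ?thesis by (simp add: fold_tails_tl)
qed

text \<open>
  The accumulator is \<open>Comma # ys\<close> while the part of the first list read so far is followed by
  \<open>ys\<close> in the second one, and \<open>[]\<close> after a mismatch.
\<close>

definition eq_step :: "letter list \<Rightarrow> letter list \<Rightarrow> letter list" where
  "eq_step s a =
     (if head a = Some Comma then if head (tl a) = head s then Comma # tl (tl a) else [] else [])"

lemma length_eq_step: "length (eq_step s a) \<le> length a"
  by (cases a) (auto simp: eq_step_def)

lemma fold_tails_eq_step_Nil: "fold_tails eq_step xs [] = []"
  by (induction xs) (auto simp: eq_step_def)

lemma eq_step_Comma:
  "eq_step (x # s) (Comma # ys) =
     (case ys of [] \<Rightarrow> [] | y # ys' \<Rightarrow> if y = x then Comma # ys' else [])"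
  by (simp add: eq_step_def split: list.split)

text \<open>The mismatch state is absorbing. A longer \<open>ys\<close> leaves a nonempty rest
  behind the comma, and a shorter one produces a mismatch.\<close>

lemma fold_tails_eq_step: "fold_tails eq_step xs (Comma # ys) = [Comma] \<longleftrightarrow> xs = ys"
proof (induction xs arbitrary: ys)
  case (Cons x xs)
  show ?case
    by (cases ys) (simp_all add: eq_step_Comma fold_tails_eq_step_Nil Cons.IH eq_commute[of x])
qed auto

lemma fold_tails_eq_step_cases:
  "fold_tails eq_step xs (Comma # ys) = [] \<or> (\<exists>zs. fold_tails eq_step xs (Comma # ys) = Comma # zs)"
proof (induction xs arbitrary: ys)
  case (Cons x xs)
  show ?case
    by (cases ys) (simp_all add: eq_step_Comma fold_tails_eq_step_Nil Cons.IH)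
qed simp

lemma checkable_eq [feasible_intros]:
  assumes "feasible n f" and "feasible n g"
  shows "checkable n (\<lambda>e. f e = g e)"
proof -
  let ?r = "\<lambda>e. fold_tails eq_step (f e) (Comma # g e)"
  have "feasible (Suc (Suc n)) (\<lambda>e. eq_step (hd (tl e)) (hd e))"
    unfolding eq_step_def
    by (intro feasible_if_head feasible_if[where b = "(=)"] feasible_Cons feasible_Nil feasible_tl
        feasible_hd feasible_wk)
  then have "feasible n ?r"
    by (rule feasible_fold_tails[OF assms(1) feasible_Cons[OF assms(2)] _ polynomial_const[of 0]])
      (simp add: length_eq_step)
  then have "checkable n (\<lambda>e. head (?r e) = Some Comma \<and> head (tl (?r e)) = None)"
    by (intro feasible_intros feasible_tl)
  moreover have "head (?r e) = Some Comma \<and> head (tl (?r e)) = None \<longleftrightarrow> f e = g e" for e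
    using fold_tails_eq_step[of "f e" "g e"] fold_tails_eq_step_cases[of "f e" "g e"] by auto
  ultimately show ?thesis by simp
qed

text \<open>Nonempty suffixes stand for positions: each one shows a letter together with everything
  behind it. Quantifying over them is quantifying over positions in context.\<close>

fun tails :: "letter list \<Rightarrow> letter list list" where
  "tails [] = []"
| "tails (x # xs) = (x # xs) # tails xs"

text \<open>When \<open>f\<close> yields unary numbers, this is a sum over the positions of the
  word.\<close>

definition concat_tails :: "(letter list \<Rightarrow> letter list) \<Rightarrow> letter list \<Rightarrow> letter list" where
  "concat_tails f xs = concat (map f (tails xs))"

lemma fold_tails_append: "fold_tails (\<lambda>s a. a @ f s) xs a = a @ concat_tails f xs"
  by (induction xs arbitrary: a) (auto simp: concat_tails_def)

lemma feasible_concat_tails [feasible_intros]: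
  assumes "feasible n g" and "feasible (Suc n) (\<lambda>e. f (tl e) (hd e))"
  shows "feasible n (\<lambda>e. concat_tails (f e) (g e))"
proof -
  obtain T where "feasible_in T (Suc n) (\<lambda>e. f (tl e) (hd e))"
    using assms(2) by (auto simp: feasible_def)
  note T = feasible_inD[OF this]
  have "feasible (Suc (Suc n)) (\<lambda>e. hd e @ f (tl (tl e)) (hd (tl e)))"
    using feasible_append[OF feasible_hd feasible_wk[OF assms(2)]] by simp
  then have "feasible n (\<lambda>e. fold_tails (\<lambda>s a. a @ f e s) (g e) [])"
  proof (rule feasible_fold_tails[OF assms(1) feasible_Nil _ T(1)])
    show "length (a @ f e s) \<le> length a + T (length s + total_length e)" if "length e = n" for e s a
      using T(2)[of "s # e"] that by (simp add: total_length_def)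
  qed
  then show ?thesis by (simp add: fold_tails_append)
qed

text \<open>Reduces the bounded universal quantifier to an equality test: the word collects one
  comma for each counterexample.\<close>

lemma concat_tails_eq_Nil:
  "concat_tails (\<lambda>s. if Q s then [] else [Comma]) xs = [] \<longleftrightarrow> (\<forall>s\<in>set (tails xs). Q s)"
  by (induction xs) (simp_all add: concat_tails_def)

lemma checkable_ball [feasible_intros]:
  assumes "feasible n g" and "checkable (Suc n) (\<lambda>e. Q (tl e) (hd e))"
  shows "checkable n (\<lambda>e. \<forall>s\<in>set (tails (g e)). Q e s)"
proof -
  have "checkable n (\<lambda>e. concat_tails (\<lambda>s. if Q e s then [] else [Comma]) (g e) = [])"
    by (intro checkable_eq feasible_concat_tails feasible_cond assms feasible_Cons feasible_Nil)
  then show ?thesis by (simp add: concat_tails_eq_Nil)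
qed

lemma checkable_bex [feasible_intros]:
  assumes "feasible n g" and "checkable (Suc n) (\<lambda>e. Q (tl e) (hd e))"
  shows "checkable n (\<lambda>e. \<exists>s\<in>set (tails (g e)). Q e s)"
  using checkable_not[OF checkable_ball[OF assms(1) checkable_not[OF assms(2)]]] by simp

section \<open>The decision procedure\<close>

text \<open>
  All numbers are in unary notation, except the number of manipulators.  \<open>capped_product\<close> evaluates
  \<open>n * length k\<close> by Horner's rule for a binary numeral \<open>n\<close>, most significant bit first.  Capping
  the intermediate results by the length of \<open>u\<close> keeps them small.
\<close>

definition cap :: "letter list \<Rightarrow> letter list \<Rightarrow> letter list" where
  "cap u xs = drop (length (drop (length xs) u)) u"

definition capped_product :: "letter list \<Rightarrow> letter list \<Rightarrow> letter list \<Rightarrow> letter list" where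
  "capped_product u k bs =
     fold_tails (\<lambda>s a. cap u (a @ a @ (if head s = Some (Bit True) then k else []))) bs []"

text \<open>With truncated subtraction, \<open>a - (a - b)\<close> is the minimum of
  \<open>a\<close> and \<open>b\<close>.\<close>

lemma length_cap: "length (cap u xs) = min (length u) (length xs)"
  by (auto simp: cap_def)

lemma feasible_cap [feasible_intros]:
  "feasible n f \<Longrightarrow> feasible n g \<Longrightarrow> feasible n (\<lambda>e. cap (f e) (g e))"
  unfolding cap_def by (intro feasible_intros)

lemma feasible_capped_product [feasible_intros]:
  assumes "feasible n u" and "feasible n k" and "feasible n bs"
  shows "feasible n (\<lambda>e. capped_product (u e) (k e) (bs e))"
proof -
  obtain T where "feasible_in T n u" using assms(1) by (auto simp: feasible_def)
  note T = feasible_inD[OF this]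
  show ?thesis
    unfolding capped_product_def
  proof (rule feasible_fold_tails[OF assms(3) feasible_Nil _ T(1)])
    show "feasible (Suc (Suc n)) (\<lambda>e. cap (u (tl (tl e)))
        (hd e @ hd e @ (if head (hd (tl e)) = Some (Bit True) then k (tl (tl e)) else [])))"
      by (intro feasible_intros feasible_hd feasible_wk2[OF assms(1)] feasible_wk2[OF assms(2)]
          feasible_Nil feasible_wk[OF feasible_hd])
    \<comment> \<open>Thanks to the cap, the new accumulator is no longer than \<open>u e\<close>,
      whatever \<open>a\<close> is; \<open>a @ a\<close> alone would violate the growth
      condition.\<close>
    show "length (cap (u e) (a @ a @ (if head s = Some (Bit True) then k e else [])))
        \<le> length a + T (length s + total_length e)" if "length e = n" for e s a
      using T(2)[OF that] polynomial_mono[OF T(1), of "total_length e" "length s + total_length e"]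
      by (simp add: length_cap)
  qed
qed

text \<open>Needed because \<open>horner_sum\<close> puts the least significant bit first whereas
  the fold meets it last; a step that looks only at the first letter of its tail can be split off at
  the end.\<close>

lemma fold_tails_snoc:
  assumes "\<And>x s a. g (x # s) a = g [x] a"
  shows "fold_tails g (xs @ [x]) a = g [x] (fold_tails g xs a)"
proof (induction xs arbitrary: a)
  case (Cons y xs)
  then show ?case using assms[of y xs] assms[of y "xs @ [x]"] by simp
qed simp

text \<open>Capping early does no harm: \<open>min u (2 * min u x + y) = min u (2 * x + y)\<close>,
  as a value that has reached \<open>u\<close> stays there.\<close>

lemma length_capped_product:
  "length (capped_product u k (rev (map Bit bs)))
     = min (length u) (horner_sum of_bool 2 bs * length k)"
proof (induction bs)
  case (Cons b bs)
  have "capped_product u k (rev (map Bit (b # bs)))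
      = cap u (capped_product u k (rev (map Bit bs)) @ capped_product u k (rev (map Bit bs))
          @ (if b then k else []))"
    by (simp add: capped_product_def fold_tails_snoc)
  then show ?case using Cons.IH by (auto simp: length_cap algebra_simps)
qed (simp add: capped_product_def)

text \<open>
  The procedure reads the input backwards, so that every name is preceded by the comma which
  terminates it.  The tails of the reversed input which start with a comma thus correspond to the
  entries of the input, and an entry knows from what follows whether it belongs to the header (the
  block of strings formed by the number of manipulators, the distinguished candidate and the
  candidates) and how many entries of its block come before it.
\<close>

definition is_entry :: "letter list \<Rightarrow> bool" where
  "is_entry s \<longleftrightarrow> head s = Some Comma"

definition in_header :: "letter list \<Rightarrow> bool" where
  "in_header s \<longleftrightarrow> (\<forall>t\<in>set (tails s). head t \<noteq> Some Semicolon)"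

text \<open>The name comes out reversed. This is harmless for comparing names, and it yields the
  number of manipulators with its most significant bit first, as \<open>capped_product\<close>
  requires.\<close>

definition entry_name :: "letter list \<Rightarrow> letter list" where
  "entry_name s = takeWhile (\<lambda>x. x \<in> range Bit) (tl s)"

definition block_before :: "letter list \<Rightarrow> letter list" where
  "block_before s = takeWhile (\<lambda>x. x \<noteq> Semicolon) (tl s)"

definition entry_rank :: "letter list \<Rightarrow> letter list" where
  "entry_rank s = concat_tails (\<lambda>t. if is_entry t then [Comma] else []) (block_before s)"

text \<open>Ranks count from 0: in the header, rank 0 is the number of manipulators, rank 1 is
  \<open>p\<close>, and the candidates have rank at least 2.\<close>

definition is_candidate :: "letter list \<Rightarrow> bool" where
  "is_candidate s \<longleftrightarrow> is_entry s \<and> in_header s \<and> tl (entry_rank s) \<noteq> []"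

definition is_distinguished :: "letter list \<Rightarrow> bool" where
  "is_distinguished s \<longleftrightarrow> is_entry s \<and> in_header s \<and> entry_rank s = [Comma]"

definition is_manipulators :: "letter list \<Rightarrow> bool" where
  "is_manipulators s \<longleftrightarrow> is_entry s \<and> in_header s \<and> entry_rank s = []"

text \<open>The value \<open>m - 1\<close> of a first place, in unary.\<close>

definition max_points :: "letter list \<Rightarrow> letter list" where
  "max_points r = tl (concat_tails (\<lambda>s. if is_candidate s then [Comma] else []) r)"

text \<open>An entry of rank \<open>j\<close> in a vote has position \<open>j + 1\<close>, so its
  Borda value is \<open>m - (j + 1) = (m - 1) - j\<close>. The name \<open>x\<close> is expected in
  reversed form.\<close>

definition entry_score :: "letter list \<Rightarrow> letter list \<Rightarrow> letter list" where
  "entry_score r x = concat_tails (\<lambda>s. if is_entry s \<and> \<not> in_header s \<and> entry_name s = x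
     then drop (length (entry_rank s)) (max_points r) else []) r"

text \<open>Read forwards: a block may only be closed when the last string in it has been terminated
  by its comma.\<close>

definition well_separated :: "letter list \<Rightarrow> bool" where
  "well_separated r \<longleftrightarrow> (\<forall>s\<in>set (tails r). head s = Some Semicolon \<longrightarrow>
     head (tl s) \<noteq> Some (Bit False) \<and> head (tl s) \<noteq> Some (Bit True))"

definition accepts :: "letter list \<Rightarrow> bool" where
  "accepts r \<longleftrightarrow> head r = Some Semicolon \<and> well_separated r \<and>
     (\<forall>s\<in>set (tails r). is_manipulators s \<longrightarrow> head (entry_name s) \<noteq> Some (Bit False)) \<and>
     (\<exists>s\<in>set (tails r). is_distinguished s \<and>
        (\<exists>t\<in>set (tails r). is_candidate t \<and> entry_name t = entry_name s)) \<and>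
     (\<forall>s\<in>set (tails r). is_entry s \<longrightarrow>
        (\<forall>t\<in>set (tails (block_before s)). is_entry t \<longrightarrow> (in_header s \<longrightarrow> is_candidate t) \<longrightarrow>
           entry_name t \<noteq> entry_name s)) \<and>
     (\<forall>s\<in>set (tails r). is_entry s \<longrightarrow> \<not> in_header s \<longrightarrow>
        (\<exists>t\<in>set (tails r). is_candidate t \<and> entry_name t = entry_name s)) \<and>
     (\<forall>s\<in>set (tails r). is_candidate s \<longrightarrow>
        (\<forall>t\<in>set (tails r). is_distinguished t \<longrightarrow>
           (\<forall>u\<in>set (tails r). is_manipulators u \<longrightarrow>
              drop (length (entry_score r (entry_name t) @
                  capped_product (entry_score r (entry_name s)) (max_points r) (entry_name u)))
                (entry_score r (entry_name s)) = [])))"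

lemma checkable_is_entry [feasible_intros]: "feasible n f \<Longrightarrow> checkable n (\<lambda>e. is_entry (f e))"
  unfolding is_entry_def by (intro feasible_intros)

lemma checkable_in_header [feasible_intros]: "feasible n f \<Longrightarrow> checkable n (\<lambda>e. in_header (f e))"
  unfolding in_header_def by (intro feasible_intros feasible_hd)

lemma feasible_entry_name [feasible_intros]: "feasible n f \<Longrightarrow> feasible n (\<lambda>e. entry_name (f e))"
  unfolding entry_name_def by (intro feasible_takeWhile feasible_tl)

lemma feasible_block_before [feasible_intros]:
  "feasible n f \<Longrightarrow> feasible n (\<lambda>e. block_before (f e))"
  unfolding block_before_def by (intro feasible_takeWhile feasible_tl)

lemma feasible_entry_rank [feasible_intros]: "feasible n f \<Longrightarrow> feasible n (\<lambda>e. entry_rank (f e))"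
  unfolding entry_rank_def by (intro feasible_intros feasible_Cons feasible_Nil feasible_hd)

lemma checkable_is_candidate [feasible_intros]:
  "feasible n f \<Longrightarrow> checkable n (\<lambda>e. is_candidate (f e))"
  unfolding is_candidate_def by (intro feasible_intros feasible_tl feasible_Nil)

lemma checkable_is_distinguished [feasible_intros]:
  "feasible n f \<Longrightarrow> checkable n (\<lambda>e. is_distinguished (f e))"
  unfolding is_distinguished_def by (intro feasible_intros feasible_Cons feasible_Nil)

lemma checkable_is_manipulators [feasible_intros]:
  "feasible n f \<Longrightarrow> checkable n (\<lambda>e. is_manipulators (f e))"
  unfolding is_manipulators_def by (intro feasible_intros feasible_Cons feasible_Nil)

lemma feasible_max_points [feasible_intros]: "feasible n f \<Longrightarrow> feasible n (\<lambda>e. max_points (f e))"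
  unfolding max_points_def by (intro feasible_intros feasible_tl feasible_Cons feasible_Nil feasible_hd)

lemma feasible_entry_score [feasible_intros]:
  assumes "feasible n f" and "feasible n g"
  shows "feasible n (\<lambda>e. entry_score (f e) (g e))"
  unfolding entry_score_def
  by (intro feasible_intros feasible_Nil feasible_hd feasible_wk[OF assms(1)] feasible_wk[OF assms(2)]
      assms)

lemma checkable_well_separated [feasible_intros]:
  "feasible n f \<Longrightarrow> checkable n (\<lambda>e. well_separated (f e))"
  unfolding well_separated_def by (intro feasible_intros feasible_tl feasible_hd)

lemma checkable_accepts:
  assumes "feasible n f"
  shows "checkable n (\<lambda>e. accepts (f e))"
proof -
  note f = feasible_wk[OF assms] and f' = feasible_wk[OF feasible_wk[OF assms]]
    and f'' = feasible_wk[OF feasible_wk[OF feasible_wk[OF assms]]]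
  note hd = feasible_wk[OF feasible_hd] and hd' = feasible_wk[OF feasible_wk[OF feasible_hd]]
  show ?thesis
    unfolding accepts_def
    by (intro feasible_intros feasible_Nil feasible_hd assms f f' f'' hd hd')
qed

section \<open>Correctness of the decision procedure\<close>

definition rev_fields :: "bool list list \<Rightarrow> letter list" where
  "rev_fields b = rev (concat (map enc_string b))"

definition rev_blocks :: "bool list list list \<Rightarrow> letter list" where
  "rev_blocks bs = rev (concat (map enc_strings bs))"

lemma rev_fields_Nil [simp]: "rev_fields [] = []"
  by (simp add: rev_fields_def)

lemma rev_fields_snoc [simp]: "rev_fields (b @ [x]) = Comma # rev (map Bit x) @ rev_fields b"
  by (simp add: rev_fields_def enc_string_def)

lemma rev_blocks_Nil [simp]: "rev_blocks [] = []"
  by (simp add: rev_blocks_def)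

lemma rev_blocks_snoc [simp]: "rev_blocks (bs @ [b]) = Semicolon # rev_fields b @ rev_blocks bs"
  by (simp add: rev_blocks_def rev_fields_def enc_strings_def)

lemma rev_blocks_cases: "(bs = [] \<and> rev_blocks bs = []) \<or> (bs \<noteq> [] \<and> (\<exists>r. rev_blocks bs = Semicolon # r))"
  by (cases bs rule: rev_cases) auto

lemma rev_fields_cases: "rev_fields b = [] \<or> (\<exists>r. rev_fields b = Comma # r)"
  by (cases b rule: rev_cases) auto

lemma Semicolon_notin_rev_fields: "Semicolon \<notin> set (rev_fields b)"
  by (induction b rule: rev_induct) auto

text \<open>The tail of a reversed input at the comma that terminates \<open>x\<close>, when
  \<open>b\<close> are the earlier strings of the same block and \<open>bs\<close> the earlier
  blocks. Every tail starting with a comma has this form in a well-formed input.\<close>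

definition entry :: "bool list \<Rightarrow> bool list list \<Rightarrow> bool list list list \<Rightarrow> letter list" where
  "entry x b bs = Comma # rev (map Bit x) @ rev_fields b @ rev_blocks bs"

lemma sum_tails_bits:
  assumes "\<And>s. \<not> is_entry s \<Longrightarrow> f s = (0::nat)"
  shows "(\<Sum>s\<leftarrow>tails (map Bit x @ ys). f s) = (\<Sum>s\<leftarrow>tails ys. f s)"
  by (induction x) (auto simp: assms is_entry_def)

lemma sum_tails_fields:
  assumes "\<And>s. \<not> is_entry s \<Longrightarrow> f s = (0::nat)"
  shows "(\<Sum>s\<leftarrow>tails (rev_fields b @ rev_blocks bs). f s)
    = (\<Sum>j<length b. f (entry (b ! j) (take j b) bs)) + (\<Sum>s\<leftarrow>tails (rev_blocks bs). f s)"
proof (induction b rule: rev_induct)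
  case (snoc x b)
  have "(\<Sum>s\<leftarrow>tails (rev_fields (b @ [x]) @ rev_blocks bs). f s)
      = f (entry x b bs) + (\<Sum>s\<leftarrow>tails (rev_fields b @ rev_blocks bs). f s)"
    using sum_tails_bits[of f "rev x"] assms by (simp add: entry_def rev_map)
  then show ?case by (simp add: snoc.IH nth_append)
qed simp

text \<open>Tails starting with a bit or a semicolon contribute nothing. Counts, scores and
  quantifiers are all evaluated through this double sum over blocks and ranks.\<close>

lemma sum_tails_blocks:
  assumes "\<And>s. \<not> is_entry s \<Longrightarrow> f s = (0::nat)"
  shows "(\<Sum>s\<leftarrow>tails (rev_blocks bs). f s)
    = (\<Sum>i<length bs. \<Sum>j<length (bs ! i). f (entry (bs ! i ! j) (take j (bs ! i)) (take i bs)))"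
proof (induction bs rule: rev_induct)
  case (snoc b bs)
  have "(\<Sum>s\<leftarrow>tails (rev_blocks (bs @ [b])). f s)
      = (\<Sum>s\<leftarrow>tails (rev_fields b @ rev_blocks bs). f s)"
    using assms by (simp add: is_entry_def)
  then show ?case by (simp add: snoc.IH sum_tails_fields[OF assms] nth_append)
qed simp

text \<open>Counting counterexamples makes the summation formulas applicable to quantifiers.\<close>

lemma ball_tails_iff_sum:
  "(\<forall>s\<in>set (tails r). is_entry s \<longrightarrow> Q s)
    \<longleftrightarrow> (\<Sum>s\<leftarrow>tails r. of_bool (is_entry s \<and> \<not> Q s)) = (0::nat)"
  by (auto simp: sum_list_eq_0_iff of_bool_def)

lemma is_entry_entry [simp]: "is_entry (entry x b bs)"
  by (simp add: entry_def is_entry_def)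

lemma ball_tails_fields:
  "(\<forall>s\<in>set (tails (rev_fields b)). is_entry s \<longrightarrow> Q s) \<longleftrightarrow> (\<forall>j<length b. Q (entry (b ! j) (take j b) []))"
  using sum_tails_fields[of "\<lambda>s. of_bool (is_entry s \<and> \<not> Q s)" b "[]"]
  by (auto simp: ball_tails_iff_sum)

lemma ball_tails_bits:
  "(\<forall>s\<in>set (tails (map Bit x @ ys)). is_entry s \<longrightarrow> Q s)
    \<longleftrightarrow> (\<forall>s\<in>set (tails ys). is_entry s \<longrightarrow> Q s)"
  by (induction x) (auto simp: is_entry_def)

lemma ball_tails_blocks:
  "(\<forall>s\<in>set (tails (rev_blocks (h # vs))). is_entry s \<longrightarrow> Q s) \<longleftrightarrow>
     (\<forall>j<length h. Q (entry (h ! j) (take j h) [])) \<and>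
     (\<forall>i<length vs. \<forall>j<length (vs ! i). Q (entry (vs ! i ! j) (take j (vs ! i)) (h # take i vs)))"
  using sum_tails_blocks[of "\<lambda>s. of_bool (is_entry s \<and> \<not> Q s)" "h # vs"]
  by (auto simp: ball_tails_iff_sum sum.lessThan_Suc_shift simp del: sum.lessThan_Suc)

lemma bex_tails_blocks:
  "(\<exists>s\<in>set (tails (rev_blocks (h # vs))). is_entry s \<and> Q s) \<longleftrightarrow>
     (\<exists>j<length h. Q (entry (h ! j) (take j h) [])) \<or>
     (\<exists>i<length vs. \<exists>j<length (vs ! i). Q (entry (vs ! i ! j) (take j (vs ! i)) (h # take i vs)))"
  using ball_tails_blocks[of h vs "\<lambda>s. \<not> Q s"] by blast

lemma in_header_iff: "in_header s \<longleftrightarrow> Semicolon \<notin> set s"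
proof -
  have "(\<forall>t\<in>set (tails s). head t \<noteq> Some Semicolon) \<longleftrightarrow> Semicolon \<notin> set s"
    by (induction s) auto
  then show ?thesis by (simp add: in_header_def)
qed

lemma in_header_entry [simp]: "in_header (entry x b bs) \<longleftrightarrow> bs = []"
  using rev_blocks_cases[of bs] Semicolon_notin_rev_fields
  by (auto simp: in_header_iff entry_def)

lemma block_before_entry [simp]: "block_before (entry x b bs) = rev (map Bit x) @ rev_fields b"
proof -
  have "takeWhile (\<lambda>x. x \<noteq> Semicolon) (rev_fields b @ rev_blocks bs) = rev_fields b"
    using rev_blocks_cases[of bs] Semicolon_notin_rev_fields[of b]
    by (subst takeWhile_append2) auto
  moreover have "takeWhile (\<lambda>x. x \<noteq> Semicolon) (rev (map Bit x) @ ys)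
      = rev (map Bit x) @ takeWhile (\<lambda>x. x \<noteq> Semicolon) ys" for ys
    by (rule takeWhile_append2) auto
  ultimately show ?thesis by (simp add: block_before_def entry_def)
qed

lemma entry_name_entry [simp]: "entry_name (entry x b bs) = rev (map Bit x)"
proof -
  have "takeWhile (\<lambda>x. x \<in> range Bit) (rev_fields b @ rev_blocks bs) = []"
    using rev_blocks_cases[of bs] rev_fields_cases[of b] by auto
  moreover have "takeWhile (\<lambda>x. x \<in> range Bit) (rev (map Bit x) @ ys)
      = rev (map Bit x) @ takeWhile (\<lambda>x. x \<in> range Bit) ys" for ys
    by (rule takeWhile_append2) auto
  ultimately show ?thesis by (simp add: entry_name_def entry_def)
qed

lemma map_Bit_inject: "map Bit x = map Bit y \<longleftrightarrow> x = y"
  by (simp add: inj_map_eq_map inj_def)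

lemma concat_tails_if:
  "concat_tails (\<lambda>s. if Q s then [Comma] else []) xs
    = replicate (\<Sum>s\<leftarrow>tails xs. of_bool (Q s)) Comma"
  by (induction xs) (auto simp: concat_tails_def)

lemma entry_rank_entry [simp]: "entry_rank (entry x b bs) = replicate (length b) Comma"
proof -
  have "(\<Sum>s\<leftarrow>tails (map Bit (rev x) @ rev_fields b). of_bool (is_entry s)) = length b"
    using sum_tails_bits[of "\<lambda>s. of_bool (is_entry s)"]
      sum_tails_fields[of "\<lambda>s. of_bool (is_entry s)" b "[]"] by simp
  then show ?thesis by (simp add: entry_rank_def concat_tails_if rev_map)
qed

lemma kind_entry [simp]:
  "is_candidate (entry x b bs) \<longleftrightarrow> bs = [] \<and> 2 \<le> length b"
  "is_distinguished (entry x b bs) \<longleftrightarrow> bs = [] \<and> length b = 1"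
  "is_manipulators (entry x b bs) \<longleftrightarrow> bs = [] \<and> b = []"
proof -
  show "is_candidate (entry x b bs) \<longleftrightarrow> bs = [] \<and> 2 \<le> length b"
    by (cases "length b" rule: nat.exhaust) (auto simp: is_candidate_def Suc_le_eq numeral_2_eq_2)
  show "is_distinguished (entry x b bs) \<longleftrightarrow> bs = [] \<and> length b = 1"
    by (cases b) (auto simp: is_distinguished_def)
  show "is_manipulators (entry x b bs) \<longleftrightarrow> bs = [] \<and> b = []"
    by (simp add: is_manipulators_def)
qed

text \<open>Of the 3, two account for the number of manipulators and \<open>p\<close> in the header,
  and one for the step from \<open>m\<close> to \<open>m - 1\<close>.\<close>

lemma length_max_points: "length (max_points (rev_blocks (h # vs))) = length h - 3"
proof -
  have "(\<Sum>s\<leftarrow>tails (rev_blocks (h # vs)). of_bool (is_candidate s) :: nat)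
      = (\<Sum>i<length (h # vs). \<Sum>j<length ((h # vs) ! i). of_bool (is_candidate
          (entry ((h # vs) ! i ! j) (take j ((h # vs) ! i)) (take i (h # vs)))))"
    by (rule sum_tails_blocks) (simp add: is_candidate_def)
  also have "\<dots> = (\<Sum>j<length h. of_bool (2 \<le> j))"
    by (simp add: sum.lessThan_Suc_shift del: sum.lessThan_Suc sum_of_bool_eq)
  also have "(\<Sum>j<n. of_bool (2 \<le> j)) = n - 2" for n :: nat
    by (induction n) (auto simp del: sum_of_bool_eq)
  finally show ?thesis
    by (simp add: max_points_def concat_tails_if del: sum_of_bool_eq)
qed

lemma length_concat_tails: "length (concat_tails f xs) = (\<Sum>s\<leftarrow>tails xs. length (f s))"
  by (simp add: concat_tails_def length_concat comp_def)

lemma length_entry_score: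
  "length (entry_score (rev_blocks (h # vs)) (rev (map Bit c)))
    = (\<Sum>v\<leftarrow>vs. \<Sum>j<length v. if v ! j = c then length h - 3 - j else 0)"
proof -
  let ?r = "rev_blocks (h # vs)"
  let ?f = "\<lambda>s. length (if is_entry s \<and> \<not> in_header s \<and> entry_name s = rev (map Bit c)
    then drop (length (entry_rank s)) (max_points ?r) else [])"
  have "length (entry_score ?r (rev (map Bit c))) = (\<Sum>s\<leftarrow>tails ?r. ?f s)"
    by (simp add: entry_score_def length_concat_tails)
  also have "\<dots> = (\<Sum>i<length (h # vs). \<Sum>j<length ((h # vs) ! i).
      ?f (entry ((h # vs) ! i ! j) (take j ((h # vs) ! i)) (take i (h # vs))))"
    by (rule sum_tails_blocks) simp
  also have "\<dots> = (\<Sum>i<length vs. \<Sum>j<length (vs ! i).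
      if vs ! i ! j = c then length h - 3 - j else 0)"
    by (simp add: sum.lessThan_Suc_shift length_max_points map_Bit_inject
        if_distrib[of length] del: sum.lessThan_Suc rev_map cong: if_cong)
  also have "\<dots> = (\<Sum>v\<leftarrow>vs. \<Sum>j<length v. if v ! j = c then length h - 3 - j else 0)"
    by (simp add: sum_list_sum_nth atLeast0LessThan)
  finally show ?thesis .
qed

section \<open>Borda scores and the criterion for manipulability\<close>

lemma sum_points:
  assumes "distinct v"
  shows "(\<Sum>j<length v. if v ! j = c then k - j else 0)
    = (if c \<in> set v then k - length (takeWhile (\<lambda>d. d \<noteq> c) v) else 0)"
  using assms
proof (induction v arbitrary: k)
  case (Cons x v)
  have *: "(\<Sum>j<length (x # v). if (x # v) ! j = c then k - j else 0)
      = (if x = c then k else 0) + (\<Sum>j<length v. if v ! j = c then k - 1 - j else 0)"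
    by (simp add: sum.lessThan_Suc_shift diff_diff_eq del: sum.lessThan_Suc cong: if_cong)
  show ?case unfolding * using Cons.IH[of "k - 1"] Cons.prems by auto
qed simp

text \<open>As \<open>v\<close> is distinct, at most one index contributes. Indices start at 0 and
  positions at 1, hence \<open>card C - 1 - j\<close>; for an unranked candidate the sum has no
  nonzero term.\<close>

lemma points_up_eq_sum:
  assumes "is_vote C v"
  shows "points_up C v c = (\<Sum>j<length v. if v ! j = c then card C - 1 - j else 0)"
proof -
  have "distinct v"
    using assms by (auto simp: is_vote_def complete_vote_def partial_vote_def)
  then show ?thesis
    unfolding sum_points[OF \<open>distinct v\<close>] by (simp add: points_up_def borda_def position_def)
qed

lemma is_vote_iff: "is_vote C v \<longleftrightarrow> distinct v \<and> set v \<subseteq> C"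
  by (auto simp: is_vote_def complete_vote_def partial_vote_def)

lemma points_up_le: "points_up C v c \<le> card C - 1"
  by (auto simp: points_up_def borda_def position_def)

lemma score_up_append: "score_up C (vs @ ws) c = score_up C vs c + score_up C ws c"
  by (simp add: score_up_def)

lemma manipulable_up_iff:
  assumes "finite C" and "p \<in> C"
  shows "manipulable_up C p vs n
    \<longleftrightarrow> (\<forall>c\<in>C. score_up C vs c \<le> score_up C vs p + n * (card C - 1))"
proof
  assume "manipulable_up C p vs n"
  then obtain ms where ms: "length ms = n" "wins_up C (vs @ ms) p"
    by (auto simp: manipulable_up_def)
  have "score_up C ms p \<le> length ms * (card C - 1)"
    unfolding score_up_def by (induction ms) (auto intro!: add_mono points_up_le[unfolded One_nat_def])
  then show "\<forall>c\<in>C. score_up C vs c \<le> score_up C vs p + n * (card C - 1)"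
    using ms by (fastforce simp: wins_up_def score_up_append)
next
  assume *: "\<forall>c\<in>C. score_up C vs c \<le> score_up C vs p + n * (card C - 1)"
  have "score_up C (replicate n [p]) c = (if c = p then n * (card C - 1) else 0)" for c
    by (induction n) (auto simp: score_up_def points_up_def borda_def position_def)
  then have "wins_up C (vs @ replicate n [p]) p"
    using * by (auto simp: wins_up_def score_up_append)
  moreover have "is_vote C [p]" using assms by (simp add: is_vote_iff)
  ultimately show "manipulable_up C p vs n"
    unfolding manipulable_up_def by (intro exI[of _ "replicate n [p]"]) auto
qed

section \<open>Canonical binary numerals\<close>

lemma last_binary: "n \<noteq> 0 \<Longrightarrow> last (binary n)"
proof (induction n rule: binary.induct)
  case (1 n)
  have *: "binary n = odd n # binary (n div 2)" using 1 by (simp add: binary.simps)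
  show ?case
  proof (cases "n div 2 = 0")
    case True
    then have "n = 1" using 1 by (simp add: div_eq_0_iff)
    then show ?thesis by (simp add: binary.simps)
  next
    case False
    then have "binary (n div 2) \<noteq> []" by (simp add: binary.simps)
    then show ?thesis using 1 False by (simp add: *)
  qed
qed

lemma binary_horner_sum:
  "bs = [] \<or> last bs \<Longrightarrow> binary (horner_sum of_bool 2 bs) = bs"
proof (induction bs)
  case Nil
  then show ?case by (simp add: binary.simps)
next
  case (Cons b bs)
  let ?h = "horner_sum of_bool 2 bs :: nat"
  have IH: "binary ?h = bs" using Cons by (auto split: if_splits)
  \<comment> \<open>\<open>binary\<close> stops at zero, so unfolding it yields the bit
    \<open>b\<close> only if the value is nonzero. For nonempty \<open>bs\<close> this follows from
    the induction hypothesis, as \<open>binary 0\<close> is empty.\<close>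
  have "?h \<noteq> 0 \<or> b"
  proof (cases "bs = []")
    case False
    then show ?thesis using IH binary.simps[of 0] by metis
  qed (use Cons.prems in simp)
  then have "binary (of_bool b + 2 * ?h) = b # binary ?h"
    by (subst binary.simps) auto
  then show ?case by (simp add: IH)
qed

text \<open>Other bit strings also denote numbers but occur in no encoding, so the procedure has to
  reject them.\<close>

lemma binary_range: "bs \<in> range binary \<longleftrightarrow> bs = [] \<or> last bs"
proof
  assume "bs = [] \<or> last bs"
  then show "bs \<in> range binary" using binary_horner_sum by (metis rangeI)
next
  assume "bs \<in> range binary"
  then obtain n where "bs = binary n" by blast
  then show "bs = [] \<or> last bs" using last_binary[of n] by (cases "n = 0") (simp_all add: binary.simps[of 0])
qed

section \<open>Parsing of arbitrary words\<close>

lemma well_separated_simps: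
  "well_separated []"
  "well_separated (x # r) \<longleftrightarrow>
     (x = Semicolon \<longrightarrow> head r \<noteq> Some (Bit False) \<and> head r \<noteq> Some (Bit True)) \<and> well_separated r"
  by (auto simp: well_separated_def)

lemma well_separated_append_fields:
  assumes "well_separated ys"
  shows "well_separated (rev_fields b @ ys)"
proof (induction b rule: rev_induct)
  case (snoc x b)
  have "well_separated zs \<Longrightarrow> well_separated (map Bit y @ zs)" for y zs
    by (induction y) (auto simp: well_separated_simps)
  then show ?case
    using snoc.IH by (simp add: well_separated_simps rev_map)
qed (use assms in simp)

lemma well_separated_rev_blocks: "well_separated (rev_blocks bs)"
proof (induction bs rule: rev_induct)
  case (snoc b bs)
  have "head (rev_fields b @ rev_blocks bs) \<noteq> Some (Bit y)" for y
    using rev_fields_cases[of b] rev_blocks_cases[of bs] by auto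
  then show ?case
    using well_separated_append_fields[OF snoc.IH] by (simp add: well_separated_simps)
qed (simp add: well_separated_simps)

text \<open>Induction on the reversed word simulates a parser reading the original from left to
  right. Its state consists of an unfinished string \<open>x\<close>, an unfinished block
  \<open>b\<close> and the finished blocks \<open>bs\<close>; bits, commas and semicolons extend
  these in turn.\<close>

lemma well_separated_parse:
  "well_separated r \<Longrightarrow> \<exists>x b bs. r = rev (map Bit x) @ rev_fields b @ rev_blocks bs"
proof (induction r)
  case Nil
  show ?case by (intro exI[of _ "[]"]) simp
next
  case (Cons l r)
  then obtain x b bs where r: "r = rev (map Bit x) @ rev_fields b @ rev_blocks bs"
    by (auto simp: well_separated_simps)
  show ?case
  proof (cases l)
    case (Bit y)
    then have "l # r = rev (map Bit (x @ [y])) @ rev_fields b @ rev_blocks bs" by (simp add: r)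
    then show ?thesis by blast
  next
    case Comma
    then have "l # r = rev (map Bit []) @ rev_fields (b @ [x]) @ rev_blocks bs" by (simp add: r)
    then show ?thesis by blast
  next
    case Semicolon
    \<comment> \<open>If \<open>x\<close> were nonempty, its last bit would directly follow the
      semicolon in the reversed word.\<close>
    have "x \<noteq> ys @ [y]" for ys y
      using Cons.prems Semicolon by (cases y) (auto simp: well_separated_simps r)
    then have "x = []" by (cases x rule: rev_cases) auto
    then have "l # r = rev (map Bit []) @ rev_fields [] @ rev_blocks (bs @ [b])"
      by (simp add: r Semicolon)
    then show ?thesis by blast
  qed
qed

lemma rev_blocks_parse:
  assumes "well_separated r" and "head r = Some Semicolon"
  obtains h vs where "r = rev_blocks (h # vs)"
proof -
  obtain x b bs where r: "r = rev (map Bit x) @ rev_fields b @ rev_blocks bs"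
    using well_separated_parse[OF assms(1)] by blast
  have "x = []" using assms(2) r by (cases x rule: rev_cases) auto
  moreover have "b = []"
    using assms(2) r \<open>x = []\<close> by (cases b rule: rev_cases) auto
  moreover have "bs \<noteq> []" using assms(2) r \<open>x = []\<close> \<open>b = []\<close> by auto
  ultimately show ?thesis using r that by (cases bs) auto
qed

section \<open>Acceptance in terms of candidates and votes\<close>

lemma distinct_iff_nth_less: "distinct xs \<longleftrightarrow> (\<forall>j<length xs. \<forall>k<j. xs ! k \<noteq> xs ! j)"
proof
  assume *: "\<forall>j<length xs. \<forall>k<j. xs ! k \<noteq> xs ! j"
  have "xs ! i \<noteq> xs ! j" if "i < length xs" "j < length xs" "i \<noteq> j" for i j
    using *[rule_format, of i j] *[rule_format, of j i] that by (cases "i < j") auto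
  then show "distinct xs" by (simp add: distinct_conv_nth)
qed (auto simp: nth_eq_iff_index_eq)

lemma ball_block_before_entry:
  "(\<forall>t\<in>set (tails (block_before (entry x b bs))). is_entry t \<longrightarrow>
      (in_header (entry x b bs) \<longrightarrow> is_candidate t) \<longrightarrow> entry_name t \<noteq> entry_name (entry x b bs))
    \<longleftrightarrow> (\<forall>k<length b. (bs = [] \<longrightarrow> 2 \<le> k) \<longrightarrow> b ! k \<noteq> x)"
proof -
  have "block_before (entry x b bs) = map Bit (rev x) @ rev_fields b"
    by (simp add: rev_map)
  then show ?thesis
    by (simp only: ball_tails_bits ball_tails_fields) (simp add: map_Bit_inject rev_map)
qed

lemma accepts_iff:
  fixes bn p cs vs
  defines "r \<equiv> rev_blocks ((bn # p # cs) # vs)"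
    and "S \<equiv> \<lambda>c. \<Sum>v\<leftarrow>vs. \<Sum>j<length v. if v ! j = c then length cs - 1 - j else 0"
  shows "accepts r \<longleftrightarrow> (bn = [] \<or> last bn) \<and> p \<in> set cs \<and> distinct cs \<and>
    (\<forall>v\<in>set vs. distinct v \<and> set v \<subseteq> set cs) \<and>
    (\<forall>c\<in>set cs. S c \<le> S p + horner_sum of_bool 2 bn * (length cs - 1))"
proof -
  let ?h = "bn # p # cs"
  have less: "(\<forall>j<length ?h. Q j) \<longleftrightarrow> Q 0 \<and> Q 1 \<and> (\<forall>j<length cs. Q (Suc (Suc j)))" for Q
    by (simp add: All_less_Suc2)
  have kinds: "is_entry s" if "is_candidate s \<or> is_distinguished s \<or> is_manipulators s" for s
    using that by (auto simp: is_candidate_def is_distinguished_def is_manipulators_def)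
  have ball: "(\<forall>s\<in>set (tails r). Q s) \<longleftrightarrow>
      (Q (entry bn [] []) \<and> Q (entry p [bn] []) \<and>
       (\<forall>j<length cs. Q (entry (cs ! j) (bn # p # take j cs) []))) \<and>
      (\<forall>i<length vs. \<forall>j<length (vs ! i). Q (entry (vs ! i ! j) (take j (vs ! i)) (?h # take i vs)))"
    if "\<And>s. \<not> is_entry s \<Longrightarrow> Q s" for Q
  proof -
    have "(\<forall>s\<in>set (tails r). Q s) \<longleftrightarrow> (\<forall>s\<in>set (tails r). is_entry s \<longrightarrow> Q s)"
      using that by blast
    then show ?thesis unfolding r_def ball_tails_blocks less by simp
  qed
  have candidates: "(\<forall>s\<in>set (tails r). is_candidate s \<longrightarrow> Q (entry_name s))
      \<longleftrightarrow> (\<forall>c\<in>set cs. Q (rev (map Bit c)))" for Q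
    by (subst ball) (use kinds in \<open>auto simp: all_set_conv_all_nth\<close>)
  have distinguished: "(\<forall>s\<in>set (tails r). is_distinguished s \<longrightarrow> Q s) \<longleftrightarrow> Q (entry p [bn] [])" for Q
    by (subst ball) (use kinds in auto)
  have manipulators: "(\<forall>s\<in>set (tails r). is_manipulators s \<longrightarrow> Q s) \<longleftrightarrow> Q (entry bn [] [])" for Q
    by (subst ball) (use kinds in auto)
  have candidate_ex: "(\<exists>t\<in>set (tails r). is_candidate t \<and> entry_name t = rev (map Bit c))
      \<longleftrightarrow> c \<in> set cs" for c
    using candidates[of "\<lambda>x. x \<noteq> rev (map Bit c)"] by (auto simp: map_Bit_inject)
  have 1: "head r = Some Semicolon" "well_separated r"
    using rev_blocks_cases[of "?h # vs"] well_separated_rev_blocks by (auto simp: r_def)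
  \<comment> \<open>Reversal brings the most significant bit of the numeral to the front.\<close>
  have 2: "head (rev (map Bit bn)) \<noteq> Some (Bit False) \<longleftrightarrow> bn = [] \<or> last bn"
    by (cases bn rule: rev_cases) auto
  have 3: "(\<exists>s\<in>set (tails r). is_distinguished s \<and>
        (\<exists>t\<in>set (tails r). is_candidate t \<and> entry_name t = entry_name s)) \<longleftrightarrow> p \<in> set cs"
    using distinguished[of "\<lambda>s. \<not> (\<exists>t\<in>set (tails r). is_candidate t \<and> entry_name t = entry_name s)"]
      candidate_ex[of p] by auto
  \<comment> \<open>Each entry is compared only with earlier ones of its block, which is the form of
    distinctness in \<open>distinct_iff_nth_less\<close>. In the header the first two strings are
    exempt.\<close>
  have 4: "(\<forall>s\<in>set (tails r). is_entry s \<longrightarrow>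
        (\<forall>t\<in>set (tails (block_before s)). is_entry t \<longrightarrow> (in_header s \<longrightarrow> is_candidate t) \<longrightarrow>
           entry_name t \<noteq> entry_name s)) \<longleftrightarrow> distinct cs \<and> (\<forall>v\<in>set vs. distinct v)"
    by (subst ball; (unfold ball_block_before_entry)?;
        simp add: All_less_Suc2 distinct_iff_nth_less all_set_conv_all_nth)
  have 5: "(\<forall>s\<in>set (tails r). is_entry s \<longrightarrow> \<not> in_header s \<longrightarrow>
        (\<exists>t\<in>set (tails r). is_candidate t \<and> entry_name t = entry_name s))
      \<longleftrightarrow> (\<forall>v\<in>set vs. set v \<subseteq> set cs)"
    by (subst ball; simp add: candidate_ex all_set_conv_all_nth subset_code(1))
  have S: "length (entry_score r (rev (map Bit c))) = S c" for c
  proof -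
    have "length ?h - 3 = length cs - 1" by simp
    then show ?thesis unfolding r_def S_def length_entry_score by (simp only:)
  qed
  have M: "length (max_points r) = length cs - 1"
    unfolding r_def length_max_points by simp
  show ?thesis
    unfolding accepts_def candidates distinguished manipulators 3 4 5 entry_name_entry 2
      candidates[of "\<lambda>x. drop (length (entry_score r (rev (map Bit p)) @
        capped_product (entry_score r x) (max_points r) (rev (map Bit bn)))) (entry_score r x) = []"]
    using 1 by (auto simp: S M length_capped_product)
qed

lemma accepts_rev_blocks:
  "accepts (rev_blocks (h # vs)) \<longleftrightarrow>
     (\<exists>cs p n. h = binary n # p # cs \<and> is_manip_input cs p vs n \<and> manipulable_up (set cs) p vs n)"
proof -
  have score: "score_up (set cs) vs c
      = (\<Sum>v\<leftarrow>vs. \<Sum>j<length v. if v ! j = c then length cs - 1 - j else 0)"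
    if "is_manip_input cs p vs n" for cs p n c
    unfolding score_up_def
  proof (intro arg_cong[where f = sum_list] map_cong refl)
    fix v assume "v \<in> set vs"
    then have "is_vote (set cs) v" "card (set cs) = length cs"
      using that by (simp_all add: is_manip_input_def distinct_card)
    then show "points_up (set cs) v c
        = (\<Sum>j<length v. if v ! j = c then length cs - 1 - j else 0)"
      by (simp only: points_up_eq_sum)
  qed
  have iff: "accepts (rev_blocks ((binary n # p # cs) # vs)) \<longleftrightarrow>
      is_manip_input cs p vs n \<and> manipulable_up (set cs) p vs n" for n p cs
  proof (cases "is_manip_input cs p vs n")
    case True
    then show ?thesis
      using binary_range[of "binary n"]
      unfolding accepts_iff score[OF True, symmetric] horner_sum_binary
      by (auto simp: is_manip_input_def is_vote_iff manipulable_up_iff distinct_card)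
  next
    case False
    then show ?thesis unfolding accepts_iff by (auto simp: is_manip_input_def is_vote_iff)
  qed
  have "\<exists>cs p n. h = binary n # p # cs" if acc: "accepts (rev_blocks (h # vs))"
  proof -
    have "\<exists>s\<in>set (tails (rev_blocks (h # vs))). is_entry s \<and> is_distinguished s"
      using acc by (auto simp: accepts_def is_distinguished_def)
    \<comment> \<open>A distinguished entry has rank 1, so the header contains at least two
      strings.\<close>
    then obtain j where "j < length h" "length (take j h) = 1"
      unfolding bex_tails_blocks by auto
    then obtain bn p cs where h: "h = bn # p # cs"
      by (cases h rule: list.exhaust; cases "tl h") auto
    then have "bn \<in> range binary" using acc by (simp add: binary_range accepts_iff)
    with h show ?thesis by auto
  qed
  then show ?thesis using iff by blast
qed

lemma enc_input_eq_blocks: "enc_input cs p vs n = concat (map enc_strings ((binary n # p # cs) # vs))"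
  by (simp add: enc_input_def enc_strings_def)

lemma accepts_rev_iff:
  "accepts (rev w) \<longleftrightarrow>
     w \<in> {enc_input cs p vs n | cs p vs n. is_manip_input cs p vs n \<and> manipulable_up (set cs) p vs n}"
    (is "_ \<longleftrightarrow> w \<in> ?L")
proof
  assume w: "accepts (rev w)"
  then obtain h vs where hvs: "rev w = rev_blocks (h # vs)"
    using rev_blocks_parse[of "rev w"] by (auto simp: accepts_def)
  have "accepts (rev_blocks (h # vs))" using w hvs by simp
  then obtain cs p n where h: "h = binary n # p # cs"
    and "is_manip_input cs p vs n" "manipulable_up (set cs) p vs n"
    unfolding accepts_rev_blocks by blast
  moreover have "w = enc_input cs p vs n"
    using hvs unfolding h rev_blocks_def enc_input_eq_blocks by (simp only: rev_is_rev_conv)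
  ultimately show "w \<in> ?L" by blast
next
  assume "w \<in> ?L"
  then obtain cs p vs n where w: "w = enc_input cs p vs n"
    and "is_manip_input cs p vs n" "manipulable_up (set cs) p vs n" by blast
  then have "accepts (rev_blocks ((binary n # p # cs) # vs))"
    unfolding accepts_rev_blocks by blast
  then show "accepts (rev w)" by (simp add: w enc_input_eq_blocks rev_blocks_def)
qed

lemma poly_time_decidable_if_checkable:
  assumes "checkable (Suc 0) (\<lambda>e. Q (hd e))"
  shows "poly_time_decidable {w. Q w}"
proof -
  let ?f = "\<lambda>e. if Q (hd e) then [Comma] else []"
  obtain T where "feasible_in T (Suc 0) ?f" using assms by (auto simp: checkable_def feasible_def)
  note T = feasible_inD[OF this]
  \<comment> \<open>The input tape 0 is the only argument and 1 the first free stack, so the answer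
    appears on the tape that \<open>prog_tm\<close> inspects.\<close>
  obtain P where P: "computes P T 1 [0] ?f" using T(3)[of "[0]" 1] by auto
  obtain K e N where "compiled P K e N" using ex_compiled by blast
  then interpret compiled P K e N .
  \<comment> \<open>The additional step is the final transition from \<open>Skip\<close> to the
    accepting or rejecting state.\<close>
  have "polynomial (\<lambda>x. T x + 1)" using T(1) by (intro polynomial_intros)
  then obtain R where R: "\<forall>x. T x + 1 = poly R x" unfolding polynomial_def by blast
  have "\<exists>t\<le>poly R (length w). fst ((tm_step M ^^ t) (tm_start M w)) = (if Q w then 1 else 2)" for w
  proof -
    let ?\<sigma> = "\<lambda>i::nat. if i = 0 then w else []"
    let ?\<tau> = "\<lambda>i::nat. if i = 0 then input_tape M w else blank_tape"
    have "\<forall>i. stack_tape (?\<sigma> i) (?\<tau> i)"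
      by (auto simp: stack_tape_def cell_def input_tape_def blank_tape_def prog_tm_def)
    moreover have "runs P (T (length w)) ?\<sigma> (?\<sigma>(1 := ?f [w]))"
      using P[unfolded computes_def, rule_format, of ?\<sigma>] by (simp add: total_length_def)
    ultimately have "\<exists>t\<le>T (length w). \<exists>\<tau>'. halts P ?\<tau> t \<tau>' \<and>
        (\<forall>i. stack_tape ((?\<sigma>(1 := ?f [w])) i) (\<tau>' i))"
      unfolding runs_def by (elim allE[of _ ?\<tau>] impE)
    then obtain t \<tau>' where t: "t \<le> T (length w)" "halts P ?\<tau> t \<tau>'"
      and "\<forall>i. stack_tape ((?\<sigma>(1 := ?f [w])) i) (\<tau>' i)"
      by blast
    then have "stack_tape (if Q w then [Comma] else []) (\<tau>' 1)"
      by (auto dest: spec[of _ 1])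
    then have "tape_read (\<tau>' 1) = symbol (head (if Q w then [Comma] else []))"
      by (rule tape_read_stack)
    moreover have "tm_start M w = (0, map ?\<tau> [0..<K])"
      using tapes(1) unfolding tm_start_def
      by (auto simp: prog_tm_def list_eq_iff_nth_eq nth_Cons' input_tape_def)
    ultimately have "fst ((tm_step M ^^ Suc t) (tm_start M w)) = (if Q w then 1 else 2)"
      using tm_accepts[OF t(2)] by simp
    moreover have "Suc t \<le> poly R (length w)" using t(1) R[rule_format, of "length w"] by simp
    ultimately show ?thesis by blast
  qed
  then have "decides_in_time M (poly R) {w. Q w}"
    unfolding decides_in_time_def mem_Collect_eq by blast
  with is_tm show ?thesis unfolding poly_time_decidable_def by blast
qed

theorem proposition1:
  "poly_time_decidable
     {enc_input cs p vs n | cs p vs n.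
        is_manip_input cs p vs n \<and> manipulable_up (set cs) p vs n}"
proof -
  have "poly_time_decidable {w. accepts (rev w)}"
    by (rule poly_time_decidable_if_checkable)
      (rule checkable_accepts[OF feasible_rev[OF feasible_hd]])
  then show ?thesis by (simp add: accepts_rev_iff)
qed

end
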